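(* For a randomly selected hyperbolic $f\in\mathcal F$ the probability density function of the translation length $\tau=\tau(f)$ is $$H[\tau]=-\frac{4}{\pi^2}\,\tanh\frac{\tau}{2}\,\log\tanh\frac{\tau}{4},\qquad \tau> 0,$$ and the expected value of the translation length is $E[\tau]=4\log 2$.
   Context: $\mathbb S$ is the unit circle in $\mathbb C$. $\mathcal F$ is the group of matrices $A=\pm\begin{pmatrix} a & c\\ \bar c & \bar a\end{pmatrix}\in PSL(2,\mathbb C)$ with $a,c\in\mathbb C$, $|a|^2-|c|^2=1$, identified with the group of Möbius transformations $f(z)=\frac{az+c}{\bar c z+\bar a}$ preserving $\mathbb S$ and the unit disk. A random element of $\mathcal F$ is obtained by choosing, independently, $a/|a|$ and $c/|c|$ uniformly on $\mathbb S$ with respect to arclength, and $|a|\ge 1$ such that $2\arcsin(1/|a|)$ is uniformly distributed in $[0,\pi]$, with $|c|=\sqrt{|a|^2-1}$. An element is hyperbolic if $|\mathrm{tr}(A)|=2|\Re(a)|>2$; a randomly selected hyperbolic element is a random element conditioned on being hyperbolic. A hyperbolic $f$ fixes two points of $\mathbb S$ and acts on the hyperbolic line joining them (its axis) as translation by a constant hyperbolic distance $\tau(f)>0$, the translation length (hyperbolic metric of curvature $-1$ on the unit disk); it satisfies $\mathrm{tr}^2(A)-4=4\sinh^2(\tau(f)/2)$. *)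

theory Defs
  imports "HOL-Probability.Probability"
begin

section \<open>The group as a subset of \<open>PSL(2,\<complex>)\<close>\<close>

definition SL2 :: "(complex^2^2) set" where
  "SL2 = {A. det A = 1}"

definition PSL2 :: "(complex^2^2) set set" where
  "PSL2 = SL2 // {(A, B). A \<in> SL2 \<and> B \<in> SL2 \<and> (B = A \<or> B = - A)}"

definition disk_matrix :: "complex \<Rightarrow> complex \<Rightarrow> complex^2^2" where
  "disk_matrix a c = vector [vector [a, c], vector [cnj c, cnj a]]"

definition disk_group :: "(complex^2^2) set set" where
  "disk_group =
     {f \<in> PSL2. \<exists>a c. (cmod a)\<^sup>2 - (cmod c)\<^sup>2 = 1 \<and> disk_matrix a c \<in> f}"

text \<open>
  In the next two definitions the image under an even function of the matrix is a singleton
  for every element \<open>f = {A, -A}\<close> of \<open>PSL2\<close>, so \<open>the_elem\<close> is its common value.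
\<close>

definition abs_trace :: "(complex^2^2) set \<Rightarrow> real" where
  "abs_trace f = the_elem ((\<lambda>A. cmod (trace A)) ` f)"

definition moebius :: "(complex^2^2) set \<Rightarrow> complex \<Rightarrow> complex" where
  "moebius f = the_elem ((\<lambda>A z. (A$1$1 * z + A$1$2) / (A$2$1 * z + A$2$2)) ` f)"

definition hyperbolic :: "(complex^2^2) set \<Rightarrow> bool" where
  "hyperbolic f \<longleftrightarrow> abs_trace f > 2"

section \<open>Translation length\<close>

text \<open>
  Distance on the unit disk for the metric \<open>2 |dz| / (1 - |z|\<^sup>2)\<close>, which has curvature \<open>-1\<close>.
\<close>

definition hyp_dist :: "complex \<Rightarrow> complex \<Rightarrow> real" where
  "hyp_dist z w =
     arcosh (1 + 2 * (cmod (z - w))\<^sup>2 / ((1 - (cmod z)\<^sup>2) * (1 - (cmod w)\<^sup>2)))"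

text \<open>
  The hyperbolic line joining distinct points \<open>p\<close> and \<open>q\<close> of the unit circle: the part inside the
  disk of the diameter, respectively of the circle orthogonal to the unit circle, through
  \<open>p\<close> and \<open>q\<close>. The circle with centre \<open>m\<close> and radius \<open>r\<close> is orthogonal to the unit circle iff
  \<open>|m|\<^sup>2 = 1 + r\<^sup>2\<close>.
\<close>

definition hyp_line :: "complex \<Rightarrow> complex \<Rightarrow> complex set" where
  "hyp_line p q = {z \<in> ball 0 1.
     (q = - p \<and> z \<in> closed_segment p q) \<or>
     (\<exists>m r. r > 0 \<and> (cmod m)\<^sup>2 = 1 + r\<^sup>2 \<and> {p, q, z} \<subseteq> sphere m r)}"

definition axis_of :: "(complex^2^2) set \<Rightarrow> complex set" where
  "axis_of f = (\<Union>{hyp_line p q | p q. p \<noteq> q \<and> p \<in> sphere 0 1 \<and> q \<in> sphere 0 1 \<and>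
     moebius f p = p \<and> moebius f q = q})"

text \<open>
  Only meaningful for hyperbolic \<open>f\<close>, where the displacement along the axis is constant; an elliptic
  or parabolic \<open>f\<close> has empty \<open>axis_of f\<close>, leaving the value unspecified.
\<close>

definition translation_length :: "(complex^2^2) set \<Rightarrow> real" where
  "translation_length f = (THE d. \<forall>z\<in>axis_of f. hyp_dist z (moebius f z) = d)"

section \<open>Random elements\<close>

definition uniform_circle :: "complex measure" where
  "uniform_circle = distr (uniform_measure lborel {0..2 * pi}) borel cis"

text \<open>
  \<open>sgn z\<close> is \<open>z / |z|\<close>. Requiring the joint law to be the product of the three uniform laws
  expresses both the marginal laws and independence (the components have different types).
\<close>

definition random_element :: "'w measure \<Rightarrow> ('w \<Rightarrow> (complex^2^2) set) \<Rightarrow> bool" where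
  "random_element M f \<longleftrightarrow>
     prob_space M \<and> f \<in> space M \<rightarrow> disk_group \<and>
     (\<exists>a c. a \<in> borel_measurable M \<and> c \<in> borel_measurable M \<and>
        (\<forall>\<omega>\<in>space M. (cmod (a \<omega>))\<^sup>2 - (cmod (c \<omega>))\<^sup>2 = 1 \<and>
           disk_matrix (a \<omega>) (c \<omega>) \<in> f \<omega>) \<and>
        distr M (borel \<Otimes>\<^sub>M borel \<Otimes>\<^sub>M borel)
          (\<lambda>\<omega>. (sgn (a \<omega>), sgn (c \<omega>), 2 * arcsin (1 / cmod (a \<omega>))))
        = uniform_circle \<Otimes>\<^sub>M uniform_circle \<Otimes>\<^sub>M uniform_measure lborel {0..pi})"

text \<open>The probability measure \<open>M\<close> conditioned on the event that \<open>f\<close> is hyperbolic.\<close>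

definition given_hyperbolic :: "'w measure \<Rightarrow> ('w \<Rightarrow> (complex^2^2) set) \<Rightarrow> 'w measure" where
  "given_hyperbolic M f = uniform_measure M {\<omega> \<in> space M. hyperbolic (f \<omega>)}"

end

theory Submission
  imports Defs
begin

text \<open>
  An element of the group acts on the disk as \<open>z \<mapsto> (a z + c) / (cnj c z + cnj a)\<close>. A point \<open>p\<close> of the
  unit circle is fixed iff \<open>Im (cnj c p) = Im a\<close>, and the line joining two such points satisfies
  the single real equation \<open>Im a (1 + |z|\<^sup>2) = 2 Im (cnj c z)\<close>. At the points of the disk that solve
  it, the displacement is the constant \<open>arcosh (2 (Re a)\<^sup>2 - 1) = 2 arcosh |Re a|\<close>. Hence, for a hyperbolic
  element, \<open>\<tau> = 2 arcosh |Re a|\<close>, and everything depends on the law of \<open>|Re a|\<close>.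

  Write \<open>a = |a| cis \<phi>\<close> and \<open>\<theta> = 2 arcsin (1 / |a|)\<close>. Then \<open>|Re a| = |cos \<phi>| / sin (\<theta>/2)\<close>, and by
  the symmetries of the cosine this has the law of \<open>sin v / sin u\<close> with \<open>u\<close>, \<open>v\<close> independent and
  uniform on \<open>(0, \<pi>/2)\<close>. The element is hyperbolic iff \<open>u < v\<close>, which has probability 1/2, and then
  \<open>cosh (\<tau>/2) = sin v / sin u\<close>.

  For the density, fix \<open>v\<close>: the event \<open>\<tau> \<le> b\<close> is the interval \<open>arcsin (sin v / cosh (b/2)) \<le> u < v\<close>,
  whose length is the integral over \<open>0 < t < b\<close> of
  \<open>1/2 tanh (t/2) sin v / sqrt (cosh\<^sup>2 (t/2) - sin\<^sup>2 v)\<close>. After exchanging the integrals, the one over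
  \<open>v\<close> is elementary and equals \<open>arsinh (1 / sinh (t/2)) = - ln (tanh (t/4))\<close>.

  The mean is computed from the law of \<open>(u, v)\<close> rather than from the density. For fixed \<open>u\<close>,
  \<open>arcosh (sin v / sin u)\<close> is written as an integral over \<open>sin u < s < sin v\<close>, and the exchanged integral over \<open>v\<close> is the
  constant \<open>\<pi>/2\<close> divided by \<open>s\<close>. This leaves \<open>- \<pi>/2 ln (sin u)\<close>, and Euler's evaluation
  \<open>\<integral>\<^sub>0\<^sup>\<pi>\<^sup>/\<^sup>2 ln (sin u) du = - (\<pi>/2) ln 2\<close> gives \<open>4 ln 2\<close>. All integrands are nonnegative, so
  Tonelli's theorem justifies every exchange.
\<close>

section \<open>Elements of the group as maps of the disk\<close>

text \<open>
  The representatives of a class are interchangeable up to sign, so that the functions defined on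
  classes through \<open>the_elem\<close> can be evaluated on any representative.
\<close>
lemma PSL2_eq_pair:
  assumes "f \<in> PSL2" "A \<in> f"
  shows "f = {A, - A}"
proof -
  have m: "- B \<in> SL2" if "B \<in> SL2" for B
    using that by (simp add: SL2_def det_2)
  obtain B where "B \<in> SL2"
      "f = {(A, B). A \<in> SL2 \<and> B \<in> SL2 \<and> (B = A \<or> B = - A)} `` {B}"
    using assms(1) unfolding PSL2_def by (auto elim: quotientE)
  hence "f = {B, - B}" using m by auto
  thus ?thesis using assms(2) by auto
qed

lemma disk_matrix_nth [simp]:
  "disk_matrix a c $ 1 $ 1 = a" "disk_matrix a c $ 1 $ 2 = c"
  "disk_matrix a c $ 2 $ 1 = cnj c" "disk_matrix a c $ 2 $ 2 = cnj a"
  by (simp_all add: disk_matrix_def)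

definition disk_map :: "complex \<Rightarrow> complex \<Rightarrow> complex \<Rightarrow> complex" where
  "disk_map a c z = (a * z + c) / (cnj c * z + cnj a)"

lemma abs_trace_disk_matrix:
  assumes "f \<in> PSL2" "disk_matrix a c \<in> f"
  shows "abs_trace f = 2 * \<bar>Re a\<bar>"
proof -
  have "a + cnj a = of_real (2 * Re a)" by (simp add: complex_eq_iff)
  hence "cmod (a + cnj a) = 2 * \<bar>Re a\<bar>" by (simp only: norm_of_real)
  moreover have "cmod (- a - cnj a) = cmod (a + cnj a)"
    by (metis minus_add_distrib norm_minus_cancel uminus_add_conv_diff add.commute)
  ultimately show ?thesis
    unfolding abs_trace_def PSL2_eq_pair[OF assms] by (simp add: trace_def sum_2)
qed

lemma moebius_disk_matrix:
  assumes "f \<in> PSL2" "disk_matrix a c \<in> f"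
  shows "moebius f = disk_map a c"
proof -
  have "(- (a * z) - c) / (- (cnj c * z) - cnj a) = disk_map a c z" for z
  proof -
    have "- (a * z) - c = - (a * z + c)" "- (cnj c * z) - cnj a = - (cnj c * z + cnj a)" by simp_all
    thus ?thesis unfolding disk_map_def by (simp only: minus_divide_divide)
  qed
  thus ?thesis
    unfolding moebius_def PSL2_eq_pair[OF assms]
    by (simp add: disk_map_def[abs_def] fun_eq_iff)
qed

locale disk_pair =
  fixes a c :: complex
  assumes norm_diff: "(cmod a)\<^sup>2 - (cmod c)\<^sup>2 = 1"
begin

lemma denominator_nonzero:
  assumes "cmod z \<le> 1"
  shows "cnj c * z + cnj a \<noteq> 0"
proof
  assume "cnj c * z + cnj a = 0"
  hence "cnj a = - (cnj c * z)" by (simp only: add_eq_0_iff)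
  hence "cmod a = cmod c * cmod z"
    by (metis complex_mod_cnj norm_minus_cancel norm_mult)
  also have "\<dots> \<le> cmod c" using assms by (simp add: mult_left_le)
  finally have "(cmod a)\<^sup>2 \<le> (cmod c)\<^sup>2" by (simp add: power_mono)
  thus False using norm_diff by linarith
qed

text \<open>
  The numerator is the quadratic polynomial whose roots are the fixed points.
\<close>
lemma disk_map_diff:
  assumes "cmod z \<le> 1"
  shows "disk_map a c z - z
    = - (cnj c * z\<^sup>2 - 2 * \<i> * Im a * z - c) / (cnj c * z + cnj a)"
proof -
  have a: "a - cnj a = 2 * \<i> * Im a" by (simp add: complex_eq_iff)
  have "a * z + c - z * (cnj c * z + cnj a) = (a - cnj a) * z + c - cnj c * z\<^sup>2"
    by (simp add: algebra_simps power2_eq_square)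
  also have "\<dots> = - (cnj c * z\<^sup>2 - 2 * \<i> * Im a * z - c)"
    unfolding a by simp
  finally have "a * z + c - z * (cnj c * z + cnj a) = - (cnj c * z\<^sup>2 - 2 * \<i> * Im a * z - c)" .
  thus ?thesis
    using denominator_nonzero[OF assms] by (simp add: disk_map_def field_simps)
qed

lemma one_minus_norm_disk_map:
  assumes "cmod z \<le> 1"
  shows "1 - (cmod (disk_map a c z))\<^sup>2 = (1 - (cmod z)\<^sup>2) / (cmod (cnj c * z + cnj a))\<^sup>2"
proof -
  have "(cmod (cnj c * z + cnj a))\<^sup>2 - (cmod (a * z + c))\<^sup>2
      = ((cmod a)\<^sup>2 - (cmod c)\<^sup>2) * (1 - (cmod z)\<^sup>2)"
    unfolding cmod_power2 by (simp add: algebra_simps power2_eq_square)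
  moreover have "(cmod (cnj c * z + cnj a))\<^sup>2 \<noteq> 0"
    using denominator_nonzero[OF assms] by simp
  ultimately show ?thesis
    using norm_diff
    by (simp add: disk_map_def norm_divide power_divide field_simps)
qed

text \<open>
  On the unit circle, multiplying the fixed point polynomial by \<open>cnj p\<close> makes it purely imaginary.
  The quadratic equation thus becomes a linear one.
\<close>
lemma fixed_point_iff:
  assumes "cmod p = 1"
  shows "disk_map a c p = p \<longleftrightarrow> Im (cnj c * p) = Im a"
proof -
  define N where "N = cnj c * p\<^sup>2 - 2 * \<i> * Im a * p - c"
  have "p * cnj p = of_real ((cmod p)\<^sup>2)" by (rule complex_norm_square[symmetric])
  hence pp: "p * cnj p = 1" unfolding assms by simp
  have "cnj c * p + cnj a \<noteq> 0" "disk_map a c p - p = - N / (cnj c * p + cnj a)"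
    using denominator_nonzero[of p] disk_map_diff[of p] assms by (simp_all add: N_def)
  hence "disk_map a c p - p = 0 \<longleftrightarrow> N = 0" by simp
  also have "\<dots> \<longleftrightarrow> cnj p * N = 0"
    using pp by (metis mult_eq_0_iff zero_neq_one)
  also have "cnj p * N = cnj c * p * (p * cnj p) - 2 * \<i> * Im a * (p * cnj p) - c * cnj p"
    by (simp add: N_def algebra_simps power2_eq_square)
  also have "\<dots> = 2 * \<i> * of_real (Im (cnj c * p) - Im a)"
    unfolding pp by (simp add: complex_eq_iff algebra_simps)
  also have "\<dots> = 0 \<longleftrightarrow> Im (cnj c * p) = Im a"
    by (simp only: mult_eq_0_iff of_real_eq_0_iff) auto
  finally show ?thesis by simp
qed

text \<open>
  The equation in the hypothesis is that of the axis; it stays meaningful for a diameter, where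
  \<open>Im a = 0\<close>. It prescribes \<open>Im (cnj c z)\<close>, and \<open>|cnj c z|\<close> then determines \<open>Re (cnj c z)\<close> up to sign.
  With both, the squared modulus of the fixed point polynomial becomes
  \<open>(1 - |z|\<^sup>2)\<^sup>2 ((Re a)\<^sup>2 - 1)\<close>, and the dependence on \<open>z\<close> cancels in the distance.
\<close>
lemma hyp_dist_disk_map:
  assumes "cmod z < 1" and eq: "Im a * (1 + (cmod z)\<^sup>2) = 2 * Im (cnj c * z)"
  shows "hyp_dist z (disk_map a c z) = arcosh (2 * (Re a)\<^sup>2 - 1)"
proof -
  define R where "R = (cmod z)\<^sup>2"
  define N where "N = cnj c * z\<^sup>2 - 2 * \<i> * Im a * z - c"
  define D where "D = (cmod (cnj c * z + cnj a))\<^sup>2"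
  define \<alpha> where "\<alpha> = Re (cnj c * z)"
  define y where "y = Im a"
  have R: "0 \<le> R" "R < 1" using assms(1) by (auto simp: R_def abs_square_less_1)
  have D: "D > 0" using denominator_nonzero[of z] assms(1) by (simp add: D_def)
  have s: "(cmod c)\<^sup>2 - y\<^sup>2 = (Re a)\<^sup>2 - 1"
    using norm_diff by (simp add: y_def cmod_power2)
  have beta: "Im (cnj c * z) = y * (1 + R) / 2" using eq by (simp add: R_def y_def)
  have N: "(cmod N)\<^sup>2 = (1 - R)\<^sup>2 * ((Re a)\<^sup>2 - 1)"
  proof (cases "z = 0")
    case True
    hence "y = 0" using eq by (simp add: y_def)
    thus ?thesis using True s by (simp add: N_def R_def y_def)
  next
    case False
    \<comment> \<open>The product \<open>cnj z N\<close> depends on \<open>z\<close> only through \<open>|z|\<close> and \<open>cnj c z\<close>.\<close>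
    have ab: "\<alpha>\<^sup>2 + (y * (1 + R) / 2)\<^sup>2 = (cmod c)\<^sup>2 * R"
    proof -
      have "(cmod (cnj c * z))\<^sup>2 = \<alpha>\<^sup>2 + (y * (1 + R) / 2)\<^sup>2"
        unfolding cmod_power2 beta \<alpha>_def by simp
      thus ?thesis by (simp add: norm_mult power_mult_distrib R_def)
    qed
    have zz: "z * cnj z = of_real R" unfolding R_def by (rule complex_norm_square[symmetric])
    have "cnj z * N = cnj c * z * (z * cnj z) - 2 * \<i> * Im a * (z * cnj z) - cnj (cnj c * z)"
      by (simp add: N_def algebra_simps power2_eq_square)
    also have "\<dots> = Complex (\<alpha> * (R - 1)) (y * (1 + R) / 2 * (R + 1) - 2 * y * R)"
      unfolding zz using beta by (simp add: complex_eq_iff \<alpha>_def y_def algebra_simps)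
    finally have "(cmod (cnj z * N))\<^sup>2 = (\<alpha> * (R - 1))\<^sup>2 + (y * (1 + R) / 2 * (R + 1) - 2 * y * R)\<^sup>2"
      by (simp only: cmod_power2 complex.sel)
    hence "R * (cmod N)\<^sup>2 = (\<alpha> * (R - 1))\<^sup>2 + (y * (1 + R) / 2 * (R + 1) - 2 * y * R)\<^sup>2"
      by (simp only: R_def norm_mult power_mult_distrib complex_mod_cnj)
    also have "\<dots> = (1 - R)\<^sup>2 * (\<alpha>\<^sup>2 + (y * (1 + R) / 2)\<^sup>2 - y\<^sup>2 * R)"
    proof -
      obtain k where k: "y = 2 * k" by (metis field_sum_of_halves mult_2)
      have h: "y * (1 + R) / 2 = k * (1 + R)" by (simp add: k)
      show ?thesis unfolding h unfolding k by algebra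
    qed
    also have "\<dots> = (1 - R)\<^sup>2 * (R * ((Re a)\<^sup>2 - 1))"
      unfolding ab s[symmetric] by (simp add: algebra_simps)
    finally show ?thesis using False by (simp add: R_def)
  qed
  have "z - disk_map a c z = N / (cnj c * z + cnj a)"
    using disk_map_diff[of z] assms(1) unfolding N_def
    by (metis less_imp_le minus_diff_eq minus_divide_left minus_minus)
  hence n1: "(cmod (z - disk_map a c z))\<^sup>2 = (cmod N)\<^sup>2 / D"
    by (simp add: norm_divide power_divide D_def)
  have n2: "1 - (cmod (disk_map a c z))\<^sup>2 = (1 - R) / D"
    using one_minus_norm_disk_map[of z] assms(1) by (simp add: R_def D_def)
  have "2 * ((1 - R)\<^sup>2 * ((Re a)\<^sup>2 - 1) / D) / ((1 - R) * ((1 - R) / D))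
      = 2 * ((Re a)\<^sup>2 - 1)"
    using R D by (simp add: power2_eq_square)
  hence "hyp_dist z (disk_map a c z) = arcosh (1 + 2 * ((Re a)\<^sup>2 - 1))"
    by (simp only: hyp_dist_def R_def[symmetric] n1 n2 N)
  thus ?thesis by (simp add: algebra_simps)
qed

text \<open>
  A circle with centre \<open>m\<close> orthogonal to the unit circle is the set of \<open>z\<close> with \<open>2 m \<bullet> z = 1 + |z|\<^sup>2\<close>.
  The linear forms \<open>Im a (m \<bullet> u)\<close> and \<open>Im (cnj c u)\<close> both take the value \<open>Im a\<close> at \<open>p\<close> and at \<open>q\<close>, which
  are linearly independent because antipodal points lie on no such circle. The forms are therefore
  equal. A diameter only occurs for \<open>Im a = 0\<close>.
\<close>
lemma hyp_line_fixed_points: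
  assumes "cmod p = 1" "cmod q = 1" "p \<noteq> q"
    and p: "Im (cnj c * p) = Im a" and q: "Im (cnj c * q) = Im a"
    and z: "z \<in> hyp_line p q"
  shows "Im a * (1 + (cmod z)\<^sup>2) = 2 * Im (cnj c * z)"
  using z unfolding hyp_line_def
proof (safe, goal_cases)
  case 1
  from 1 obtain t where t: "z = (1 - 2 * t) *\<^sub>R p"
  proof -
    obtain t where "z = (1 - t) *\<^sub>R p + t *\<^sub>R (- p)" using 1 by (auto simp: in_segment)
    hence "z = (1 - 2 * t) *\<^sub>R p" by (simp add: scaleR_conv_of_real algebra_simps)
    thus thesis by (rule that)
  qed
  from 1 p q have "Im a = 0" by simp
  moreover have "Im (cnj c * z) = (1 - 2 * t) * Im (cnj c * p)"
    unfolding t by (simp add: algebra_simps)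
  ultimately show ?case using p by simp
next
  case (2 m r)
  define dot where "dot u v = Re u * Re v + Im u * Im v" for u v
  have dist_sq: "(cmod (m - u))\<^sup>2 = (cmod m)\<^sup>2 - 2 * dot m u + (cmod u)\<^sup>2" for u
    unfolding cmod_power2 dot_def by (simp add: power2_eq_square algebra_simps)
  have "cmod (m - p) = r" "cmod (m - q) = r" "cmod (m - z) = r"
    using 2 by (auto simp: dist_norm)
  hence mp: "dot m p = 1" and mq: "dot m q = 1" and mz: "2 * dot m z = 1 + (cmod z)\<^sup>2"
    using dist_sq[of p] dist_sq[of q] dist_sq[of z] 2 assms(1,2) by auto
  have det: "Re p * Im q - Im p * Re q \<noteq> 0"
  proof
    assume det0: "Re p * Im q - Im p * Re q = 0"
    have np: "(Re p)\<^sup>2 + (Im p)\<^sup>2 = 1" and nq: "(Re q)\<^sup>2 + (Im q)\<^sup>2 = 1"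
      using assms(1,2) by (metis cmod_power2 one_power2)+
    have "(dot p q)\<^sup>2 + (Re p * Im q - Im p * Re q)\<^sup>2
        = ((Re p)\<^sup>2 + (Im p)\<^sup>2) * ((Re q)\<^sup>2 + (Im q)\<^sup>2)"
      unfolding dot_def by algebra
    hence "(dot p q)\<^sup>2 = 1" unfolding det0 np nq by simp
    hence "dot p q = 1 \<or> dot p q = - 1" by (simp add: power2_eq_1_iff)
    thus False
    proof
      assume d: "dot p q = 1"
      have "(Re p - Re q)\<^sup>2 + (Im p - Im q)\<^sup>2 = 0"
        using np nq d by (simp add: dot_def power2_eq_square algebra_simps)
      hence "p = q" by (simp add: complex_eq_iff sum_power2_eq_zero_iff)
      thus False using assms(3) by simp
    next
      assume d: "dot p q = - 1"
      have "(Re p + Re q)\<^sup>2 + (Im p + Im q)\<^sup>2 = 0"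
        using np nq d by (simp add: dot_def power2_eq_square algebra_simps)
      hence "q = - p" by (simp add: complex_eq_iff sum_power2_eq_zero_iff)
      thus False using mp mq by (simp add: dot_def)
    qed
  qed
  \<comment> \<open>The vector representing the difference of the two linear forms.\<close>
  define w1 where "w1 = Im a * Re m + Im c"
  define w2 where "w2 = Im a * Im m - Re c"
  have cross: "Im (cnj c * u) = Re c * Im u - Im c * Re u" for u by simp
  have "w1 * Re u + w2 * Im u = Im a * dot m u - Im (cnj c * u)" for u
    unfolding w1_def w2_def dot_def cross by (simp add: algebra_simps)
  note w = this
  have wp: "w1 * Re p + w2 * Im p = 0" and wq: "w1 * Re q + w2 * Im q = 0"
    unfolding w mp mq p q by simp_all
  have "w1 * (Re p * Im q - Im p * Re q) = 0" "w2 * (Re p * Im q - Im p * Re q) = 0"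
    using wp wq by algebra+
  hence "w1 = 0" "w2 = 0" using det by simp_all
  hence "Im a * dot m z = Im (cnj c * z)" using w[of z] by simp
  thus ?case using mz by (metis mult.left_commute)
qed

text \<open>
  If \<open>Im a = 0\<close>, the fixed points are antipodal and the line contains the origin. Otherwise the
  line lies on the circle with centre \<open>\<i> c / Im a\<close>, and the point of that circle closest to the
  origin is in the disk. Without a point on the axis the translation length would be unspecified.
\<close>
lemma hyp_line_nonempty:
  assumes "cmod p = 1" "cmod q = 1" "p \<noteq> q" and x: "\<bar>Re a\<bar> > 1"
    and p: "Im (cnj c * p) = Im a" and q: "Im (cnj c * q) = Im a"
  shows "hyp_line p q \<noteq> {}"
proof -
  have c2: "(cmod c)\<^sup>2 = (Re a)\<^sup>2 - 1 + (Im a)\<^sup>2"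
    using norm_diff by (simp add: cmod_power2)
  have x2: "(Re a)\<^sup>2 - 1 > 0" using abs_le_square_iff[of "Re a" 1] x by simp
  show ?thesis
  proof (cases "Im a = 0")
    case True
    have c0: "cmod c > 0" using c2 x2 True by (metis add.right_neutral norm_zero power_zero_numeral less_irrefl zero_less_norm_iff)
    have real: "cnj c * u = of_real (Re (cnj c * u))" "(Re (cnj c * u))\<^sup>2 = (cmod c)\<^sup>2"
      if "cmod u = 1" "Im (cnj c * u) = Im a" for u
    proof -
      show e: "cnj c * u = of_real (Re (cnj c * u))" using that True by (simp add: complex_eq_iff)
      have "(cmod (cnj c * u))\<^sup>2 = (Re (cnj c * u))\<^sup>2 + (Im (cnj c * u))\<^sup>2" by (rule cmod_power2)
      thus "(Re (cnj c * u))\<^sup>2 = (cmod c)\<^sup>2" using that True by (simp add: norm_mult)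
    qed
    have "Re (cnj c * p) = Re (cnj c * q) \<or> Re (cnj c * p) = - Re (cnj c * q)"
      using real(2)[OF assms(1) p] real(2)[OF assms(2) q] by (metis power2_eq_iff)
    hence "cnj c * p = cnj c * q \<or> cnj c * p = cnj c * (- q)"
      using real(1)[OF assms(1) p] real(1)[OF assms(2) q] by (metis mult_minus_right of_real_minus)
    hence "q = - p" using c0 assms(3) by (metis minus_minus mult_cancel_left mult_minus_right complex_cnj_zero_iff norm_zero less_irrefl)
    moreover have "0 \<in> closed_segment p (- p)"
      by (simp add: in_segment, rule exI[of _ "1/2"], simp add: scaleR_conv_of_real)
    ultimately have "0 \<in> hyp_line p q" by (simp add: hyp_line_def)
    thus ?thesis by blast
  next
    case False
    define m where "m = \<i> * c / Im a"
    define r where "r = sqrt ((Re a)\<^sup>2 - 1) / \<bar>Im a\<bar>"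
    have r: "r > 0" using x2 False by (simp add: r_def)
    have r2: "r\<^sup>2 = ((Re a)\<^sup>2 - 1) / (Im a)\<^sup>2"
      using x2 by (simp add: r_def power_divide)
    have "(cmod m)\<^sup>2 = (cmod c)\<^sup>2 / (Im a)\<^sup>2"
      by (simp add: m_def norm_mult norm_divide power_divide)
    hence m2: "(cmod m)\<^sup>2 = 1 + r\<^sup>2" unfolding r2 c2 using False by (simp add: field_simps)
    have on: "cmod (m - u) = r" if "cmod u = 1" "Im (cnj c * u) = Im a" for u
    proof -
      define X where "X = Re m * Re u + Im m * Im u"
      have "X = Im (cnj c * u) / Im a" by (simp add: X_def m_def diff_divide_distrib)
      hence X: "X = 1" unfolding that(2) using False by simp
      have "(cmod (m - u))\<^sup>2 = (cmod m)\<^sup>2 - 2 * X + (cmod u)\<^sup>2"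
        unfolding cmod_power2 X_def by (simp add: power2_eq_square algebra_simps)
      hence "(cmod (m - u))\<^sup>2 = r\<^sup>2" unfolding X m2 that(1) by simp
      thus ?thesis using r by (simp add: power2_eq_iff_nonneg)
    qed
    have m1: "cmod m > 0" using m2 by (metis add_pos_nonneg norm_zero power_zero_numeral zero_less_norm_iff zero_le_power2 zero_less_one less_irrefl)
    have mr: "r < cmod m" by (rule power2_less_imp_less) (use m2 in auto)
    have "(cmod m)\<^sup>2 < (1 + r)\<^sup>2" unfolding m2 using r by (simp add: power2_eq_square algebra_simps)
    hence mr': "cmod m < 1 + r" using r by (auto intro: power2_less_imp_less)
    define z where "z = (1 - r / cmod m) *\<^sub>R m"
    have "cmod z = cmod m - r"
      using m1 mr by (simp add: z_def field_simps)
    moreover have "m - z = (r / cmod m) *\<^sub>R m" by (simp add: z_def algebra_simps)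
    hence "cmod (m - z) = r" using m1 r by simp
    ultimately have "z \<in> ball 0 1" "{p, q, z} \<subseteq> sphere m r"
      using mr' on[OF assms(1) p] on[OF assms(2) q] by (simp_all add: dist_norm)
    hence "z \<in> hyp_line p q" using r m2 unfolding hyp_line_def by blast
    thus ?thesis by blast
  qed
qed

end

section \<open>Axis and translation length\<close>

lemma mem_axis_of_iff:
  assumes "disk_pair a c" "f \<in> PSL2" "disk_matrix a c \<in> f"
  shows "z \<in> axis_of f \<longleftrightarrow> (\<exists>p q. p \<noteq> q \<and> cmod p = 1 \<and> cmod q = 1 \<and>
     Im (cnj c * p) = Im a \<and> Im (cnj c * q) = Im a \<and> z \<in> hyp_line p q)"
proof -
  interpret disk_pair a c by fact
  have fixed: "moebius f p = p \<longleftrightarrow> Im (cnj c * p) = Im a" if "cmod p = 1" for p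
    using fixed_point_iff[OF that] moebius_disk_matrix[OF assms(2,3)] by simp
  have "z \<in> axis_of f \<longleftrightarrow> (\<exists>p q. p \<noteq> q \<and> cmod p = 1 \<and> cmod q = 1 \<and>
     moebius f p = p \<and> moebius f q = q \<and> z \<in> hyp_line p q)"
    unfolding axis_of_def by auto
  thus ?thesis using fixed by metis
qed

lemma arcosh_double:
  assumes "x \<ge> (1::real)"
  shows "arcosh (2 * x\<^sup>2 - 1) = 2 * arcosh x"
proof -
  have "cosh (2 * arcosh x) = 2 * x\<^sup>2 - 1"
    using assms by (simp add: cosh_double cosh_square_eq sinh_square_eq)
  thus ?thesis using assms arcosh_cosh_real[of "2 * arcosh x"] by simp
qed

text \<open>
  A random variable must be measurable on the whole space, so the value off the hyperbolic elements
  matters as well. The identity fixes every point and has displacement 0 on all lines. Every other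
  element with \<open>|Re a| \<le> 1\<close> has at most one fixed point on the circle, hence an empty axis, and the
  definite description then denotes one fixed unknown number.
\<close>
lemma translation_length_disk_matrix:
  assumes "disk_pair a c" and f: "f \<in> PSL2" "disk_matrix a c \<in> f"
  shows "translation_length f =
    (if \<bar>Re a\<bar> > 1 then 2 * arcosh \<bar>Re a\<bar>
     else if c = 0 \<and> Im a = 0 then 0 else (THE d. True))"
proof -
  interpret disk_pair a c by fact
  note axis = mem_axis_of_iff[OF assms]
  note moeb = moebius_disk_matrix[OF f]
  have the: "translation_length f = d"
    if "axis_of f \<noteq> {}" "\<And>z. z \<in> axis_of f \<Longrightarrow> hyp_dist z (disk_map a c z) = d" for d
    unfolding translation_length_def moeb using that by (intro the_equality) auto
  consider (hyp) "\<bar>Re a\<bar> > 1" | (id) "\<bar>Re a\<bar> \<le> 1" "c = 0" "Im a = 0"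
    | (no_axis) "\<bar>Re a\<bar> \<le> 1" "\<not> (c = 0 \<and> Im a = 0)" by linarith
  thus ?thesis
  proof cases
    case hyp
    define s where "s = sqrt ((Re a)\<^sup>2 - 1)"
    have s: "s > 0" using abs_le_square_iff[of "Re a" 1] hyp by (simp add: s_def)
    have s2: "(cmod c)\<^sup>2 = s\<^sup>2 + (Im a)\<^sup>2"
    proof -
      have "s\<^sup>2 = (Re a)\<^sup>2 - 1" using s by (simp add: s_def)
      thus ?thesis using norm_diff cmod_power2[of a] by linarith
    qed
    have c0: "cmod c > 0" using s s2
      by (metis add_pos_nonneg norm_zero power_zero_numeral zero_less_norm_iff zero_le_power2 zero_less_power less_irrefl)
    \<comment> \<open>The fixed points are \<open>P s\<close> and \<open>P (- s)\<close>: the two solutions of \<open>Im (cnj c p) = Im a\<close>, \<open>|p| = 1\<close>.\<close>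
    define P where "P t = c * Complex t (Im a) / of_real ((cmod c)\<^sup>2)" for t
    have P1: "cmod (P t) = 1" if "t\<^sup>2 = s\<^sup>2" for t
    proof -
      have "cmod (Complex t (Im a)) = sqrt ((cmod c)\<^sup>2)" by (simp only: complex_norm that s2)
      thus ?thesis using c0 by (simp add: P_def norm_mult norm_divide power2_eq_square)
    qed
    have P2: "cnj c * P t = Complex t (Im a)" for t
    proof -
      have "cnj c * P t = (c * cnj c) / of_real ((cmod c)\<^sup>2) * Complex t (Im a)"
        by (simp add: P_def)
      thus ?thesis using c0 by (simp flip: complex_norm_square)
    qed
    have "P s \<noteq> P (- s)" using P2[of s] P2[of "- s"] s by auto
    have P3: "Im (cnj c * P t) = Im a" for t unfolding P2 by simp
    have Ps: "cmod (P s) = 1" "cmod (P (- s)) = 1" using P1 by simp_all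
    obtain z0 where "z0 \<in> hyp_line (P s) (P (- s))"
      using hyp_line_nonempty[OF Ps \<open>P s \<noteq> P (- s)\<close> hyp P3 P3] by blast
    hence "z0 \<in> axis_of f"
      unfolding axis using Ps P3 \<open>P s \<noteq> P (- s)\<close> by metis
    hence ne: "axis_of f \<noteq> {}" by blast
    have "hyp_dist z (disk_map a c z) = 2 * arcosh \<bar>Re a\<bar>" if "z \<in> axis_of f" for z
    proof -
      from that obtain p q where pq: "p \<noteq> q" "cmod p = 1" "cmod q = 1"
          "Im (cnj c * p) = Im a" "Im (cnj c * q) = Im a" "z \<in> hyp_line p q"
        unfolding axis by blast
      have "cmod z < 1" using pq(6) by (simp add: hyp_line_def)
      moreover have "Im a * (1 + (cmod z)\<^sup>2) = 2 * Im (cnj c * z)"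
        by (rule hyp_line_fixed_points[OF pq(2,3,1,4,5,6)])
      ultimately have "hyp_dist z (disk_map a c z) = arcosh (2 * (Re a)\<^sup>2 - 1)"
        by (rule hyp_dist_disk_map)
      thus ?thesis using arcosh_double[of "\<bar>Re a\<bar>"] hyp by simp
    qed
    from the[OF ne this] show ?thesis using hyp by simp
  next
    case id
    have "0 \<in> closed_segment 1 (- 1 :: complex)"
      by (simp add: in_segment, rule exI[of _ "1/2"], simp add: scaleR_conv_of_real)
    hence "0 \<in> hyp_line 1 (- 1)" by (simp add: hyp_line_def)
    hence "0 \<in> axis_of f"
      unfolding axis using id by (intro exI[of _ 1] exI[of _ "- 1"]) simp
    hence ne: "axis_of f \<noteq> {}" by blast
    have "a = cnj a" using id by (simp add: complex_eq_iff)
    moreover have "a \<noteq> 0" using norm_diff id by auto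
    ultimately have "disk_map a c z = z" for z
      using id by (auto simp: disk_map_def)
    hence "hyp_dist z (disk_map a c z) = 0" for z by (simp add: hyp_dist_def)
    from the[OF ne this] show ?thesis using id by simp
  next
    case no_axis
    have "p = q" if pq: "cmod p = 1" "cmod q = 1" "Im (cnj c * p) = Im a" "Im (cnj c * q) = Im a" for p q
    proof -
      have le: "(cmod c)\<^sup>2 \<le> (Im a)\<^sup>2"
        using norm_diff no_axis(1) abs_le_square_iff[of "Re a" 1] by (simp add: cmod_power2)
      have re: "Re (cnj c * u) = 0" if "cmod u = 1" "Im (cnj c * u) = Im a" for u
      proof -
        have "(cmod c)\<^sup>2 = (cmod (cnj c * u))\<^sup>2" using that by (simp add: norm_mult)
        also have "\<dots> = (Re (cnj c * u))\<^sup>2 + (Im a)\<^sup>2" unfolding cmod_power2 that ..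
        finally have "(Re (cnj c * u))\<^sup>2 \<le> 0" using le by linarith
        thus ?thesis by simp
      qed
      have "cnj c * p = cnj c * q"
        using re[OF pq(1,3)] re[OF pq(2,4)] pq(3,4) by (simp only: complex_eq_iff)
      moreover have "c \<noteq> 0" using pq(3) no_axis(2) by auto
      ultimately show "p = q" by simp
    qed
    hence "z \<notin> axis_of f" for z unfolding axis by metis
    hence "axis_of f = {}" by blast
    thus ?thesis using no_axis by (auto simp: translation_length_def)
  qed
qed

section \<open>Integration tools\<close>

text \<open>
  Derivatives are only required inside the interval: several primitives below involve arcsin or
  arcosh and have an infinite derivative at an end point.
\<close>
lemma nn_integral_FTC_open:
  fixes F f :: "real \<Rightarrow> real"
  assumes ab: "a \<le> b" and cont: "continuous_on {a..b} F"
    and deriv: "\<And>x. a < x \<Longrightarrow> x < b \<Longrightarrow> (F has_field_derivative f x) (at x)"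
    and nonneg: "\<And>x. a < x \<Longrightarrow> x < b \<Longrightarrow> 0 \<le> f x"
  shows "(\<integral>\<^sup>+x. ennreal (f x) * indicator {a<..<b} x \<partial>lborel) = ennreal (F b - F a)"
proof -
  have "(f has_integral (F b - F a)) {a..b}"
    using deriv by (intro fundamental_theorem_of_calculus_interior ab cont)
      (auto simp: has_real_derivative_iff_has_vector_derivative)
  hence "(f has_integral (F b - F a)) {a<..<b}"
    by (simp add: has_integral_Icc_iff_Ioo)
  thus ?thesis using nonneg by (intro nn_integral_has_integral_lebesgue') auto
qed

lemma nn_integral_reflect_Ioo:
  fixes f :: "real \<Rightarrow> ennreal"
  assumes [measurable]: "f \<in> borel_measurable borel"
  shows "(\<integral>\<^sup>+x. f (b - x) * indicator {0<..<b} x \<partial>lborel) = (\<integral>\<^sup>+x. f x * indicator {0<..<b} x \<partial>lborel)"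
  by (subst (2) nn_integral_real_affine[where c = "-1" and t = b])
     (auto intro!: nn_integral_cong simp: indicator_def)

lemma nn_integral_split_Ioo:
  fixes f :: "real \<Rightarrow> ennreal"
  assumes [measurable]: "f \<in> borel_measurable borel" and "a < b" "b < c"
  shows "(\<integral>\<^sup>+x. f x * indicator {a<..<c} x \<partial>lborel)
    = (\<integral>\<^sup>+x. f x * indicator {a<..<b} x \<partial>lborel) + (\<integral>\<^sup>+x. f x * indicator {b<..<c} x \<partial>lborel)"
proof -
  have "(\<integral>\<^sup>+x. f x * indicator {a<..<c} x \<partial>lborel)
    = (\<integral>\<^sup>+x. f x * indicator {a<..<b} x + f x * indicator {b<..<c} x \<partial>lborel)"
    using AE_lborel_singleton[of b] assms(2,3)
    by (intro nn_integral_cong_AE) (auto simp: indicator_def elim!: eventually_mono)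
  thus ?thesis by (simp add: nn_integral_add)
qed

lemma borel_measurable_hyperbolic [measurable]:
  "(sinh :: real \<Rightarrow> real) \<in> borel_measurable borel" "(cosh :: real \<Rightarrow> real) \<in> borel_measurable borel"
  "(tanh :: real \<Rightarrow> real) \<in> borel_measurable borel"
  by (intro borel_measurable_continuous_onI continuous_intros; simp)+

lemma borel_measurable_arcosh [measurable]: "(arcosh :: real \<Rightarrow> real) \<in> borel_measurable borel"
  unfolding arcosh_def[abs_def] by measurable

section \<open>The ratio of the sines of two uniform angles\<close>

text \<open>
  Up to the factor \<open>4 / \<pi>\<^sup>2\<close>, the expectation of \<open>h (sin v / sin u)\<close> for independent angles \<open>u\<close>, \<open>v\<close>
  uniformly distributed on \<open>(0, \<pi>/2)\<close>.
\<close>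
definition sin_ratio_integral :: "(real \<Rightarrow> ennreal) \<Rightarrow> ennreal" where
  "sin_ratio_integral h = (\<integral>\<^sup>+v. (\<integral>\<^sup>+u. h (sin v / sin u) * indicator {0<..<pi/2} u \<partial>lborel)
     * indicator {0<..<pi/2} v \<partial>lborel)"

lemma sin_ratio_integral_inner_cong:
  assumes "\<And>v. 0 < v \<Longrightarrow> v < pi/2 \<Longrightarrow>
    (\<integral>\<^sup>+u. h (sin v / sin u) * indicator {0<..<pi/2} u \<partial>lborel) = g v"
  shows "sin_ratio_integral h = (\<integral>\<^sup>+v. g v * indicator {0<..<pi/2} v \<partial>lborel)"
  unfolding sin_ratio_integral_def using assms by (intro nn_integral_cong) (auto simp: indicator_def)

lemma one_less_sin_ratio_iff:
  assumes "0 < u" "u < pi/2" "0 < v" "v < pi/2"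
  shows "1 < sin v / sin u \<longleftrightarrow> u < v"
proof -
  have "sin u > 0" using assms by (intro sin_gt_zero) auto
  moreover have "sin u < sin v \<longleftrightarrow> u < v" using assms by (intro sin_mono_less_eq) auto
  ultimately show ?thesis by (simp add: field_simps)
qed

lemma sin_ratio_integral_gt_1:
  "sin_ratio_integral (indicator {1<..}) = ennreal (pi\<^sup>2 / 8)"
proof -
  have "sin_ratio_integral (indicator {1<..}) = (\<integral>\<^sup>+v. ennreal v * indicator {0<..<pi/2} v \<partial>lborel)"
  proof (rule sin_ratio_integral_inner_cong, goal_cases)
    case (1 v)
    have "(\<integral>\<^sup>+u. indicator {1<..} (sin v / sin u) * indicator {0<..<pi/2} u \<partial>lborel)
        = (\<integral>\<^sup>+u. indicator {0<..<v} u \<partial>lborel)"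
      using 1 one_less_sin_ratio_iff[of _ v]
      by (intro nn_integral_cong) (auto simp: indicator_def)
    thus ?case using 1 by simp
  qed
  also have "\<dots> = ennreal ((pi/2)\<^sup>2 / 2 - 0\<^sup>2 / 2)"
    by (rule nn_integral_FTC_open) (auto intro!: continuous_intros derivative_eq_intros)
  finally show ?thesis by (simp add: power_divide)
qed

lemma sin_ratio_integral_between:
  assumes b: "0 < b"
  shows "sin_ratio_integral (indicator {1<..cosh (b/2)})
    = (\<integral>\<^sup>+v. ennreal (v - arcsin (sin v / cosh (b/2))) * indicator {0<..<pi/2} v \<partial>lborel)"
proof (rule sin_ratio_integral_inner_cong, goal_cases)
  case (1 v)
  define C where "C = cosh (b/2)"
  define w where "w = arcsin (sin v / C)"
  have C: "C > 1" using b cosh_real_nonneg_less_iff[of 0 "b/2"] by (simp add: C_def)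
  have sv: "0 < sin v" "sin v < 1"
    using 1 sin_gt_zero[of v] sin_monotone_2pi[of v "pi/2"] by auto
  have q: "0 < sin v / C" "sin v / C < sin v" using sv C by (auto simp: field_simps)
  have w: "0 < w" "w < v"
    using q sv 1 arcsin_less_mono[of 0 "sin v / C"] arcsin_less_mono[of "sin v / C" "sin v"]
    by (auto simp: w_def arcsin_sin)
  have "sin v / sin u \<le> C \<longleftrightarrow> w \<le> u" if u: "0 < u" "u < pi/2" for u
  proof -
    have "sin u > 0" using u by (intro sin_gt_zero) auto
    hence "sin v / sin u \<le> C \<longleftrightarrow> sin v / C \<le> sin u" using C by (simp add: field_simps)
    also have "\<dots> \<longleftrightarrow> w \<le> u"
      unfolding w_def using q sv u by (subst arcsin_le_iff) auto
    finally show ?thesis .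
  qed
  hence "(\<integral>\<^sup>+u. indicator {1<..C} (sin v / sin u) * indicator {0<..<pi/2} u \<partial>lborel)
      = (\<integral>\<^sup>+u. indicator {w..<v} u \<partial>lborel)"
    using 1 w one_less_sin_ratio_iff[of _ v]
    by (intro nn_integral_cong) (auto simp: indicator_def)
  thus ?case using w by (simp add: C_def w_def)
qed

section \<open>The density of the translation length\<close>

text \<open>
  This is where the logarithm in the density comes from: with \<open>y = t/4\<close>, the hyperbolic sine of
  \<open>- ln (tanh y)\<close> is half of \<open>coth y - tanh y = 1 / (sinh y cosh y)\<close>.
\<close>
lemma arsinh_inverse_sinh:
  assumes "t > (0::real)"
  shows "arsinh (1 / sinh (t / 2)) = - ln (tanh (t / 4))"
proof -
  define y where "y = t / 4"
  have y: "0 < sinh y" "0 < cosh y" "0 < tanh y" using assms by (simp_all add: y_def)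
  have "sinh (- ln (tanh y)) = (inverse (tanh y) - tanh y) / 2"
    using y by (simp add: sinh_ln_real field_simps)
  also have "\<dots> = ((cosh y)\<^sup>2 - (sinh y)\<^sup>2) / (2 * sinh y * cosh y)"
    using y by (simp add: tanh_def field_simps power2_eq_square)
  also have "\<dots> = 1 / sinh (2 * y)" by (simp add: sinh_double cosh_square_eq)
  also have "2 * y = t / 2" by (simp add: y_def)
  finally show ?thesis by (metis arsinh_sinh_real y_def)
qed

text \<open>
  For fixed \<open>v\<close> the condition \<open>cosh (t/2) = sin v / sin u\<close> makes \<open>u = arcsin (sin v / cosh (t/2))\<close> a
  decreasing function of \<open>t\<close>; the integrand is \<open>-2 du/dt\<close>.
\<close>
lemma nn_integral_density_in_t:
  assumes v: "0 < v" "v < pi / 2" and b: "0 < b"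
  shows "(\<integral>\<^sup>+t. ennreal (tanh (t/2) * (sin v / sqrt ((cosh (t/2))\<^sup>2 - (sin v)\<^sup>2)))
           * indicator {0<..<b} t \<partial>lborel)
    = ennreal (2 * (v - arcsin (sin v / cosh (b/2))))"
proof -
  have sv: "0 < sin v" "sin v < 1"
    using v sin_gt_zero[of v] sin_monotone_2pi[of v "pi/2"] by auto
  let ?F = "\<lambda>t. - 2 * arcsin (sin v / cosh (t/2))"
  have lt: "sin v < cosh x" for x :: real using sv cosh_real_ge_1[of x] by linarith
  have bd: "- 1 < sin v / cosh x" "sin v / cosh x < 1" for x :: real
    using lt[of x] sv cosh_real_pos[of x] by (auto simp: field_simps)
  have "(\<integral>\<^sup>+t. ennreal (tanh (t/2) * (sin v / sqrt ((cosh (t/2))\<^sup>2 - (sin v)\<^sup>2)))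
           * indicator {0<..<b} t \<partial>lborel) = ennreal (?F b - ?F 0)"
  proof (rule nn_integral_FTC_open)
    show "continuous_on {0..b} ?F"
      using bd by (intro continuous_intros) (auto intro: less_imp_le)
  next
    fix t :: real assume t: "0 < t" "t < b"
    define C where "C = cosh (t/2)"
    have C: "C > 0" "C > sin v" using lt by (simp_all add: C_def)
    have d: "C\<^sup>2 - (sin v)\<^sup>2 > 0" using C sv by (simp add: power_strict_mono)
    have "1 - (sin v / C)\<^sup>2 = (C\<^sup>2 - (sin v)\<^sup>2) / C\<^sup>2"
      using C by (simp add: field_simps)
    hence sq: "sqrt (1 - (sin v / C)\<^sup>2) = sqrt (C\<^sup>2 - (sin v)\<^sup>2) / C"
      using C by (simp add: real_sqrt_divide)
    have "(?F has_field_derivative - 2 * (inverse (sqrt (1 - (sin v / C)\<^sup>2)) * (- (sin v * (sinh (t/2) * (1/2))) / (C * C)))) (at t)"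
      unfolding C_def using bd[of "t/2"]
      by (auto intro!: derivative_eq_intros simp: divide_simps)
    also have "- 2 * (inverse (sqrt (1 - (sin v / C)\<^sup>2)) * (- (sin v * (sinh (t/2) * (1/2))) / (C * C)))
       = sinh (t/2) / C * (sin v / sqrt (C\<^sup>2 - (sin v)\<^sup>2))"
      unfolding sq using C d by (simp add: field_simps)
    finally show "(?F has_field_derivative tanh (t/2) * (sin v / sqrt ((cosh (t/2))\<^sup>2 - (sin v)\<^sup>2))) (at t)"
      by (simp add: C_def tanh_def)
    show "0 \<le> tanh (t/2) * (sin v / sqrt ((cosh (t/2))\<^sup>2 - (sin v)\<^sup>2))"
      using t sv d by (intro mult_nonneg_nonneg divide_nonneg_nonneg) (simp_all add: C_def tanh_def lt[THEN less_imp_le])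
  qed (use b in simp)
  also have "?F b - ?F 0 = 2 * (v - arcsin (sin v / cosh (b/2)))"
    using v by (simp add: arcsin_sin)
  finally show ?thesis .
qed

text \<open>
  The denominator is \<open>sqrt (sinh\<^sup>2 (t/2) + cos\<^sup>2 v)\<close>, so \<open>- arsinh (cos v / sinh (t/2))\<close> is a primitive.
\<close>
lemma nn_integral_density_in_v:
  assumes t: "0 < t"
  shows "(\<integral>\<^sup>+v. ennreal (sin v / sqrt ((cosh (t/2))\<^sup>2 - (sin v)\<^sup>2)) * indicator {0<..<pi/2} v \<partial>lborel)
    = ennreal (- ln (tanh (t/4)))"
proof -
  define S where "S = sinh (t/2)"
  have S: "S > 0" using t by (simp add: S_def)
  have den: "(cosh (t/2))\<^sup>2 - (sin v)\<^sup>2 = S\<^sup>2 + (cos v)\<^sup>2" for v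
    by (simp add: S_def cosh_square_eq cos_squared_eq)
  let ?F = "\<lambda>v. - arsinh (cos v / S)"
  have "(\<integral>\<^sup>+v. ennreal (sin v / sqrt ((cosh (t/2))\<^sup>2 - (sin v)\<^sup>2)) * indicator {0<..<pi/2} v \<partial>lborel)
      = ennreal (?F (pi/2) - ?F 0)"
  proof (rule nn_integral_FTC_open)
    show "continuous_on {0..pi/2} ?F"
      using S by (intro continuous_intros) auto
  next
    fix v :: real assume v: "0 < v" "v < pi/2"
    have "(cos v / S)\<^sup>2 + 1 = (S\<^sup>2 + (cos v)\<^sup>2) / S\<^sup>2" using S by (simp add: field_simps)
    hence sq: "sqrt ((cos v / S)\<^sup>2 + 1) = sqrt (S\<^sup>2 + (cos v)\<^sup>2) / S"
      using S by (simp add: real_sqrt_divide)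
    have "(?F has_field_derivative - (1 / sqrt ((cos v / S)\<^sup>2 + 1) * (- sin v / S))) (at v)"
      using S by (auto intro!: derivative_eq_intros DERIV_chain2[OF arsinh_real_has_field_derivative])
    thus "(?F has_field_derivative sin v / sqrt ((cosh (t/2))\<^sup>2 - (sin v)\<^sup>2)) (at v)"
      unfolding sq den using S by simp
    show "0 \<le> sin v / sqrt ((cosh (t/2))\<^sup>2 - (sin v)\<^sup>2)"
      unfolding den using v by (simp add: sin_ge_zero)
  qed simp
  also have "?F (pi/2) - ?F 0 = - ln (tanh (t/4))"
    using arsinh_inverse_sinh[OF t] by (simp add: S_def)
  finally show ?thesis .
qed

definition translation_length_density :: "real \<Rightarrow> real" where
  "translation_length_density t = (if t > 0 then - (4 / pi\<^sup>2) * tanh (t / 2) * ln (tanh (t / 4)) else 0)"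

lemma translation_length_density_measurable [measurable]: "translation_length_density \<in> borel_measurable borel"
  unfolding translation_length_density_def[abs_def] by measurable

lemma translation_length_density_nonneg: "0 \<le> translation_length_density t"
proof (cases "t > 0")
  case True
  hence "0 < tanh (t/4)" "tanh (t/4) \<le> 1" "0 < tanh (t/2)"
    using tanh_real_lt_1[of "t/4"] by (simp_all add: less_imp_le)
  hence "ln (tanh (t/4)) \<le> 0" by simp
  thus ?thesis using \<open>0 < tanh (t/2)\<close> True
    by (simp add: translation_length_density_def mult_nonneg_nonpos divide_nonpos_pos)
qed (simp add: translation_length_density_def)

text \<open>
  The factor \<open>8 / \<pi>\<^sup>2\<close> is \<open>4 / \<pi>\<^sup>2\<close> divided by the probability 1/2 of being hyperbolic.
\<close>
lemma nn_integral_translation_length_density: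
  assumes b: "0 < b"
  shows "(\<integral>\<^sup>+t. ennreal (translation_length_density t) * indicator {..b} t \<partial>lborel)
    = ennreal (8 / pi\<^sup>2) * sin_ratio_integral (indicator {1<..cosh (b/2)})"
proof -
  have sin_ratio_bound: "- 1 \<le> sin v / cosh (b/2)" "sin v / cosh (b/2) \<le> 1" for v
    using sin_le_one[of v] sin_ge_minus_one[of v] cosh_real_ge_1[of "b/2"] cosh_real_pos[of "b/2"]
    by (simp_all only: pos_le_divide_eq pos_divide_le_eq)
  define K where "K v t = (if 0 < v \<and> v < pi/2 \<and> 0 < t \<and> t < b
     then ennreal (tanh (t/2) * (sin v / sqrt ((cosh (t/2))\<^sup>2 - (sin v)\<^sup>2))) else 0)" for v t
  have K_meas: "(\<lambda>(v, t). K v t) \<in> borel_measurable (lborel \<Otimes>\<^sub>M lborel)"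
    unfolding K_def by measurable
  have "(\<integral>\<^sup>+t. ennreal (translation_length_density t) * indicator {..b} t \<partial>lborel)
      = (\<integral>\<^sup>+t. ennreal (4 / pi\<^sup>2) * (\<integral>\<^sup>+v. K v t \<partial>lborel) \<partial>lborel)"
  proof (rule nn_integral_cong_AE, use AE_lborel_singleton[of b] in eventually_elim)
    case (elim t)
    show ?case
    proof (cases "0 < t \<and> t < b")
      case True
      hence th: "0 < tanh (t/4)" "tanh (t/4) \<le> 1" "0 < tanh (t/2)"
        using tanh_real_lt_1[of "t/4"] by (simp_all add: less_imp_le)
      have "(\<integral>\<^sup>+v. K v t \<partial>lborel) = (\<integral>\<^sup>+v. ennreal (tanh (t/2)) *
          (ennreal (sin v / sqrt ((cosh (t/2))\<^sup>2 - (sin v)\<^sup>2)) * indicator {0<..<pi/2} v) \<partial>lborel)"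
        using True th by (intro nn_integral_cong) (auto simp: K_def indicator_def simp flip: ennreal_mult')
      also have "\<dots> = ennreal (tanh (t/2)) * ennreal (- ln (tanh (t/4)))"
        using True by (subst nn_integral_cmult) (simp_all add: nn_integral_density_in_v)
      finally show ?thesis
        using True th by (simp add: translation_length_density_def mult.assoc flip: ennreal_mult')
    next
      case False
      hence "K v t = 0" for v unfolding K_def by (metis (mono_tags))
      thus ?thesis using False elim by (auto simp: translation_length_density_def)
    qed
  qed
  also have "\<dots> = ennreal (4 / pi\<^sup>2) * (\<integral>\<^sup>+t. \<integral>\<^sup>+v. K v t \<partial>lborel \<partial>lborel)"
    unfolding K_def by (intro nn_integral_cmult) measurable
  also have "(\<integral>\<^sup>+t. \<integral>\<^sup>+v. K v t \<partial>lborel \<partial>lborel) = (\<integral>\<^sup>+v. \<integral>\<^sup>+t. K v t \<partial>lborel \<partial>lborel)"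
    using lborel_pair.Fubini'[OF K_meas] by simp
  also have "\<dots> = (\<integral>\<^sup>+v. 2 * (ennreal (v - arcsin (sin v / cosh (b/2))) * indicator {0<..<pi/2} v) \<partial>lborel)"
  proof (intro nn_integral_cong, goal_cases)
    case (1 v)
    show ?case
    proof (cases "0 < v \<and> v < pi/2")
      case True
      have "(\<integral>\<^sup>+t. K v t \<partial>lborel) = (\<integral>\<^sup>+t. ennreal (tanh (t/2) *
          (sin v / sqrt ((cosh (t/2))\<^sup>2 - (sin v)\<^sup>2))) * indicator {0<..<b} t \<partial>lborel)"
        using True by (intro nn_integral_cong) (auto simp: K_def indicator_def)
      also have "\<dots> = ennreal (2 * (v - arcsin (sin v / cosh (b/2))))"
        by (rule nn_integral_density_in_t) (use True b in auto)
      also have "\<dots> = 2 * ennreal (v - arcsin (sin v / cosh (b/2)))"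
        by (simp only: ennreal_mult' zero_le_numeral ennreal_numeral)
      finally show ?thesis using True by simp
    next
      case False
      hence "K v t = 0" for t by (auto simp: K_def)
      thus ?thesis using False by auto
    qed
  qed
  also have "\<dots> = 2 * sin_ratio_integral (indicator {1<..cosh (b/2)})"
  proof -
    have [measurable]: "(\<lambda>v. arcsin (sin v / cosh (b/2))) \<in> borel_measurable borel"
      by (intro borel_measurable_continuous_onI continuous_intros ballI)
         (use sin_ratio_bound in auto)
    show ?thesis
      unfolding sin_ratio_integral_between[OF b] by (intro nn_integral_cmult) measurable
  qed
  also have "ennreal (4 / pi\<^sup>2) * (2 * sin_ratio_integral (indicator {1<..cosh (b/2)}))
      = ennreal (8 / pi\<^sup>2) * sin_ratio_integral (indicator {1<..cosh (b/2)})"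
    by (simp add: mult.assoc[symmetric] flip: ennreal_numeral ennreal_mult')
  finally show ?thesis .
qed

section \<open>The integral of the logarithm of the sine\<close>

lemma Jordan_sin_ge:
  assumes "0 \<le> x" "x \<le> pi / 2"
  shows "2 * x / pi \<le> sin x"
proof -
  have "concave_on {0..pi/2} sin"
    by (rule f''_le0_imp_concave[where f' = cos and f'' = "\<lambda>x. - sin x"])
       (auto intro!: derivative_eq_intros sin_ge_zero)
  from concave_onD[OF this, of "2 * x / pi" 0 "pi/2"] show ?thesis
    using assms by (simp add: field_simps)
qed

text \<open>
  Euler's argument. Let \<open>N\<close> be the integral. By symmetry it is also the integral of
  \<open>- ln (cos x)\<close> and of \<open>- ln (sin (2 x))\<close>. The duplication formula then yields
  \<open>2 N = N + (\<pi>/2) ln 2\<close>, from which \<open>N\<close> may be cancelled because it is finite.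
\<close>
lemma nn_integral_minus_ln_sin:
  "(\<integral>\<^sup>+x. ennreal (- ln (sin x)) * indicator {0<..<pi/2} x \<partial>lborel) = ennreal (pi / 2 * ln 2)"
proof -
  let ?f = "\<lambda>x::real. ennreal (- ln (sin x))"
  define N where "N = (\<integral>\<^sup>+x. ?f x * indicator {0<..<pi/2} x \<partial>lborel)"
  have sin: "0 < sin x" "sin x < 1" if "0 < x" "x < pi/2" for x :: real
    using that sin_gt_zero[of x] sin_monotone_2pi[of x "pi/2"] by auto
  have fin: "N < \<infinity>"
  proof -
    have "N \<le> (\<integral>\<^sup>+x. ennreal (4 / sqrt x) * indicator {0<..<pi/2} x \<partial>lborel)"
      unfolding N_def
    proof (intro nn_integral_mono, goal_cases)
      case (1 x)
      have "- ln (sin x) \<le> 4 / sqrt x" if x: "0 < x" "x < pi/2"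
      proof -
        have "- ln (sin x) \<le> - ln (x / 4)"
        proof -
          have "x / 4 \<le> 2 * x / pi" using x pi_less_4 by (simp add: field_simps)
          thus ?thesis using Jordan_sin_ge[of x] x sin[of x] by simp
        qed
        \<comment> \<open>Halving the exponent bounds the logarithm by an integrable power.\<close>
        also have "\<dots> = 2 * ln (2 / sqrt x)"
          using x by (simp add: ln_div ln_sqrt ln_mult flip: ln_realpow) (use ln_realpow[of 2 2] in simp)
        also have "\<dots> \<le> 2 * (2 / sqrt x)"
          using x ln_le_minus_one[of "2 / sqrt x"] by simp
        finally show ?thesis by simp
      qed
      thus ?case by (auto simp: indicator_def intro!: ennreal_leI)
    qed
    also have "\<dots> = ennreal (8 * sqrt (pi/2) - 8 * sqrt 0)"
      by (rule nn_integral_FTC_open[where F = "\<lambda>x. 8 * sqrt x"])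
         (auto intro!: continuous_intros derivative_eq_intros simp: field_simps)
    finally show ?thesis by (rule order_le_less_trans) simp
  qed
  have cos: "(\<integral>\<^sup>+x. ennreal (- ln (cos x)) * indicator {0<..<pi/2} x \<partial>lborel) = N"
    using nn_integral_reflect_Ioo[of ?f "pi/2"] by (simp add: N_def sin_diff)
  have "(\<integral>\<^sup>+x. ?f x * indicator {0<..<pi} x \<partial>lborel) = N + (\<integral>\<^sup>+x. ?f x * indicator {pi/2<..<pi} x \<partial>lborel)"
    unfolding N_def by (rule nn_integral_split_Ioo) auto
  also have "(\<integral>\<^sup>+x. ?f x * indicator {pi/2<..<pi} x \<partial>lborel)
      = (\<integral>\<^sup>+x. ennreal (- ln (cos x)) * indicator {0<..<pi/2} x \<partial>lborel)"
    by (subst nn_integral_real_affine[where c = 1 and t = "pi/2"])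
       (auto intro!: nn_integral_cong simp: indicator_def sin_add)
  finally have "(\<integral>\<^sup>+x. ?f x * indicator {0<..<pi} x \<partial>lborel) = 2 * N"
    unfolding cos by (simp add: mult_2)
  also have "(\<integral>\<^sup>+x. ?f x * indicator {0<..<pi} x \<partial>lborel)
      = 2 * (\<integral>\<^sup>+x. ?f (2 * x) * indicator {0<..<pi/2} x \<partial>lborel)"
    by (subst nn_integral_real_affine[where c = 2 and t = 0])
       (auto intro!: nn_integral_cong arg_cong2[where f = "(*)"] simp: indicator_def)
  finally have half: "(\<integral>\<^sup>+x. ?f (2 * x) * indicator {0<..<pi/2} x \<partial>lborel) = N"
    by (simp add: ennreal_mult_cancel_left)
  have "2 * N = (\<integral>\<^sup>+x. ?f x * indicator {0<..<pi/2} x + ennreal (- ln (cos x)) * indicator {0<..<pi/2} x \<partial>lborel)"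
    by (subst nn_integral_add) (auto simp: cos N_def[symmetric] mult_2)
  also have "\<dots> = (\<integral>\<^sup>+x. ?f (2 * x) * indicator {0<..<pi/2} x + ennreal (ln 2) * indicator {0<..<pi/2} x \<partial>lborel)"
  proof (intro nn_integral_cong, goal_cases)
    case (1 x)
    have "ennreal (- ln (sin x)) + ennreal (- ln (cos x)) = ?f (2 * x) + ennreal (ln 2)"
      if x: "0 < x" "x < pi/2"
    proof -
      have c: "0 < cos x" "cos x \<le> 1" using x cos_gt_zero[of x] by auto
      have s2: "0 < sin (2 * x)" "sin (2 * x) \<le> 1" using x sin_gt_zero[of "2 * x"] by auto
      have "ln (sin (2 * x)) = ln 2 + ln (sin x) + ln (cos x)"
        unfolding sin_double using sin[OF x] c by (simp add: ln_mult)
      moreover have "ln (sin x) \<le> 0" "ln (cos x) \<le> 0" "ln (sin (2 * x)) \<le> 0"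
        using sin[OF x] c s2 by (simp_all only: ln_le_zero_iff less_imp_le)
      ultimately show ?thesis
        by (subst (1 2) ennreal_plus[symmetric]) (simp_all only: neg_0_le_iff_le ln_ge_zero, auto)
    qed
    thus ?case by (simp add: indicator_def)
  qed
  also have "\<dots> = N + ennreal (ln 2) * ennreal (pi / 2)"
    by (subst nn_integral_add) (auto simp: half nn_integral_cmult_indicator)
  also have "ennreal (ln 2) * ennreal (pi / 2) = ennreal (pi / 2 * ln 2)"
    by (simp add: mult.commute flip: ennreal_mult')
  finally have "N + N = N + ennreal (pi / 2 * ln 2)" unfolding mult_2 .
  hence "N = ennreal (pi / 2 * ln 2)"
    using fin by (metis ennreal_add_left_cancel infinity_ennreal_def less_irrefl)
  thus ?thesis unfolding N_def .
qed

section \<open>The mean of the translation length\<close>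

lemma nn_integral_arcosh_in_s:
  assumes "0 < k" "k < m"
  shows "(\<integral>\<^sup>+s. ennreal (m / (s * sqrt (m\<^sup>2 - s\<^sup>2))) * indicator {k<..<m} s \<partial>lborel)
    = ennreal (arcosh (m / k))"
proof -
  let ?F = "\<lambda>s. - arcosh (m / s)"
  have "(\<integral>\<^sup>+s. ennreal (m / (s * sqrt (m\<^sup>2 - s\<^sup>2))) * indicator {k<..<m} s \<partial>lborel) = ennreal (?F m - ?F k)"
  proof (rule nn_integral_FTC_open)
    show "continuous_on {k..m} ?F"
      using assms by (intro continuous_intros) auto
  next
    fix s assume s: "k < s" "s < m"
    hence d: "m\<^sup>2 - s\<^sup>2 > 0" "s > 0" using assms by (simp_all add: power_strict_mono)
    have "(m / s)\<^sup>2 - 1 = (m\<^sup>2 - s\<^sup>2) / s\<^sup>2" using d by (simp add: field_simps)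
    hence sq: "sqrt ((m / s)\<^sup>2 - 1) = sqrt (m\<^sup>2 - s\<^sup>2) / s" using d by (simp add: real_sqrt_divide)
    have "(?F has_field_derivative - (1 / sqrt ((m / s)\<^sup>2 - 1) * (- m / (s * s)))) (at s)"
      using d s by (auto intro!: derivative_eq_intros DERIV_chain2[OF arcosh_real_has_field_derivative])
    thus "(?F has_field_derivative m / (s * sqrt (m\<^sup>2 - s\<^sup>2))) (at s)"
      unfolding sq using d by (simp add: mult.commute)
    show "0 \<le> m / (s * sqrt (m\<^sup>2 - s\<^sup>2))" using d s assms by simp
  qed (use assms in simp)
  also have "?F m - ?F k = arcosh (m / k)" using assms by simp
  finally show ?thesis .
qed

text \<open>
  The independence of \<open>s\<close> is what makes the mean computable.
\<close>
lemma nn_integral_arcosh_in_v: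
  assumes s: "0 < s" "s < 1"
  shows "(\<integral>\<^sup>+v. ennreal (sin v / sqrt ((sin v)\<^sup>2 - s\<^sup>2)) * indicator {arcsin s<..<pi/2} v \<partial>lborel)
    = ennreal (pi / 2)"
proof -
  define w where "w = sqrt (1 - s\<^sup>2)"
  have w2: "w\<^sup>2 = 1 - s\<^sup>2" and w: "w > 0" using s by (auto simp: w_def power_less_one_iff abs_square_le_1 abs_square_less_1)
  have as: "0 < arcsin s" "arcsin s < pi/2" using s arcsin_lt_bounded[of s] arcsin_less_mono[of 0 s] by auto
  have cas: "cos (arcsin s) = w" using s by (simp add: cos_arcsin w_def)
  have lew: "0 \<le> cos v \<and> cos v \<le> w" if "arcsin s \<le> v" "v \<le> pi/2" for v
    using that as cos_monotone_0_pi_le[of "arcsin s" v] cas by (auto intro!: cos_ge_zero)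
  have ltw: "0 < cos v \<and> cos v < w" if "arcsin s < v" "v < pi/2" for v
    using that as cos_monotone_0_pi[of "arcsin s" v] cas by (auto intro!: cos_gt_zero)
  let ?F = "\<lambda>v. - arcsin (cos v / w)"
  have "(\<integral>\<^sup>+v. ennreal (sin v / sqrt ((sin v)\<^sup>2 - s\<^sup>2)) * indicator {arcsin s<..<pi/2} v \<partial>lborel)
      = ennreal (?F (pi/2) - ?F (arcsin s))"
  proof (rule nn_integral_FTC_open)
    show "continuous_on {arcsin s..pi/2} ?F"
    proof (intro continuous_intros ballI, goal_cases)
      case (2 v) thus ?case using lew[of v] w by (auto simp: field_simps)
    qed (use w in auto)
  next
    fix v assume v: "arcsin s < v" "v < pi/2"
    have cv: "0 < cos v" "cos v < w" using ltw[OF v] by auto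
    have "1 - (cos v / w)\<^sup>2 = (w\<^sup>2 - (cos v)\<^sup>2) / w\<^sup>2" using w by (simp add: field_simps)
    also have "w\<^sup>2 - (cos v)\<^sup>2 = (sin v)\<^sup>2 - s\<^sup>2" by (simp add: w2 cos_squared_eq)
    finally have sq: "sqrt (1 - (cos v / w)\<^sup>2) = sqrt ((sin v)\<^sup>2 - s\<^sup>2) / w"
      using w by (simp add: real_sqrt_divide)
    have "(?F has_field_derivative - (inverse (sqrt (1 - (cos v / w)\<^sup>2)) * (- sin v / w))) (at v)"
      using w cv by (auto intro!: derivative_eq_intros simp: field_simps)
    thus "(?F has_field_derivative sin v / sqrt ((sin v)\<^sup>2 - s\<^sup>2)) (at v)"
      unfolding sq using w by (simp add: field_simps)
    have "(cos v)\<^sup>2 \<le> w\<^sup>2" using cv by (simp add: power_mono)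
    hence "0 \<le> (sin v)\<^sup>2 - s\<^sup>2" by (simp add: w2 cos_squared_eq)
    moreover have "0 \<le> sin v" using v as by (intro sin_ge_zero) auto
    ultimately show "0 \<le> sin v / sqrt ((sin v)\<^sup>2 - s\<^sup>2)" by simp
  qed (use as in simp)
  also have "?F (pi/2) - ?F (arcsin s) = pi / 2" using w cas by simp
  finally show ?thesis .
qed

lemma nn_integral_inverse:
  assumes "0 < k" "k < 1"
  shows "(\<integral>\<^sup>+s. ennreal (1 / s) * indicator {k<..<1} s \<partial>lborel) = ennreal (- ln k)"
proof -
  have "(\<integral>\<^sup>+s. ennreal (1 / s) * indicator {k<..<1} s \<partial>lborel) = ennreal (ln 1 - ln k)"
    using assms by (intro nn_integral_FTC_open) (auto intro!: continuous_intros derivative_eq_intros)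
  thus ?thesis by simp
qed

lemma sin_less_iff_less_arcsin:
  assumes "0 < v" "v < pi/2" "0 \<le> s" "s \<le> 1"
  shows "s < sin v \<longleftrightarrow> arcsin s < v"
  using arcsin_le_iff[of s v] le_arcsin_iff[of s v] assms by (auto simp: not_le[symmetric])

text \<open>
  The region \<open>u < v < \<pi>/2\<close>, \<open>sin u < s < sin v\<close> is also \<open>sin u < s < 1\<close>, \<open>arcsin s < v < \<pi>/2\<close>. In the
  second order both integrals are elementary, whereas a primitive of the arcosh in \<open>v\<close> is not.
\<close>
lemma nn_integral_arcosh_sin_ratio:
  assumes u: "0 < u" "u < pi/2"
  shows "(\<integral>\<^sup>+v. ennreal (arcosh (sin v / sin u)) * indicator {u<..<pi/2} v \<partial>lborel)
    = ennreal (pi / 2) * ennreal (- ln (sin u))"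
proof -
  define k where "k = sin u"
  have k: "0 < k" "k < 1"
    using u sin_gt_zero[of u] sin_monotone_2pi[of u "pi/2"] by (auto simp: k_def)
  have ask: "arcsin k = u" using u by (simp add: k_def arcsin_sin)
  define K where "K v s = (if 0 < v \<and> v < pi/2 \<and> k < s \<and> s < sin v
     then ennreal (sin v / (s * sqrt ((sin v)\<^sup>2 - s\<^sup>2))) else 0)" for v s
  have K_meas: "(\<lambda>(v, s). K v s) \<in> borel_measurable (lborel \<Otimes>\<^sub>M lborel)"
    unfolding K_def by measurable
  have "(\<integral>\<^sup>+v. ennreal (arcosh (sin v / sin u)) * indicator {u<..<pi/2} v \<partial>lborel)
      = (\<integral>\<^sup>+v. \<integral>\<^sup>+s. K v s \<partial>lborel \<partial>lborel)"
  proof (intro nn_integral_cong, goal_cases)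
    case (1 v)
    show ?case
    proof (cases "u < v \<and> v < pi/2")
      case True
      hence "k < sin v" using u k by (simp add: sin_less_iff_less_arcsin ask)
      hence "ennreal (arcosh (sin v / sin u))
        = (\<integral>\<^sup>+s. ennreal (sin v / (s * sqrt ((sin v)\<^sup>2 - s\<^sup>2))) * indicator {k<..<sin v} s \<partial>lborel)"
        using k by (simp add: nn_integral_arcosh_in_s k_def)
      also have "\<dots> = (\<integral>\<^sup>+s. K v s \<partial>lborel)"
        using True u by (intro nn_integral_cong) (auto simp: K_def)
      finally show ?thesis using True by simp
    next
      case False
      have "K v s = 0" for s
      proof -
        have "\<not> k < sin v" if "0 < v" "v < pi/2" using that False k by (simp add: sin_less_iff_less_arcsin ask)
        thus ?thesis by (auto simp: K_def)
      qed
      thus ?thesis using False by auto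
    qed
  qed
  also have "\<dots> = (\<integral>\<^sup>+s. \<integral>\<^sup>+v. K v s \<partial>lborel \<partial>lborel)"
    using lborel_pair.Fubini'[OF K_meas] by simp
  also have "\<dots> = (\<integral>\<^sup>+s. ennreal (pi/2) * (ennreal (1 / s) * indicator {k<..<1} s) \<partial>lborel)"
  proof (intro nn_integral_cong, goal_cases)
    case (1 s)
    show ?case
    proof (cases "k < s \<and> s < 1")
      case True
      hence s: "0 < s" "s < 1" using k by auto
      have as: "0 < arcsin s" using s arcsin_less_mono[of 0 s] by auto
      have "(\<integral>\<^sup>+v. K v s \<partial>lborel) = (\<integral>\<^sup>+v. ennreal (1 / s) *
          (ennreal (sin v / sqrt ((sin v)\<^sup>2 - s\<^sup>2)) * indicator {arcsin s<..<pi/2} v) \<partial>lborel)"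
      proof (intro nn_integral_cong, goal_cases)
        case (1 v)
        show ?case
        proof (cases "0 < v \<and> v < pi/2")
          case v: True
          hence iff: "s < sin v \<longleftrightarrow> arcsin s < v" using s by (simp add: sin_less_iff_less_arcsin)
          show ?thesis
            using True v s by (simp add: K_def iff indicator_def ennreal_mult'[symmetric])
        qed (use as in \<open>auto simp: K_def indicator_def\<close>)
      qed
      also have "\<dots> = ennreal (1 / s) * ennreal (pi / 2)"
        by (subst nn_integral_cmult) (simp_all add: nn_integral_arcosh_in_v s)
      finally show ?thesis using True by (simp add: mult.commute)
    next
      case False
      hence "K v s = 0" for v using sin_le_one[of v] by (auto simp: K_def simp del: sin_le_one)
      thus ?thesis using False by auto
    qed
  qed
  also have "\<dots> = ennreal (pi/2) * ennreal (- ln k)"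
    by (subst nn_integral_cmult) (simp_all add: nn_integral_inverse k)
  finally show ?thesis by (simp add: k_def)
qed

lemma sin_ratio_integral_arcosh:
  "sin_ratio_integral (\<lambda>x. ennreal (2 * arcosh x) * indicator {1<..} x) = ennreal (pi\<^sup>2 / 2 * ln 2)"
proof -
  define K where "K v u = (if 0 < u \<and> u < v \<and> v < pi/2 then ennreal (arcosh (sin v / sin u)) else 0)" for v u
  have K_meas: "(\<lambda>(v, u). K v u) \<in> borel_measurable (lborel \<Otimes>\<^sub>M lborel)"
    unfolding K_def by measurable
  have "sin_ratio_integral (\<lambda>x. ennreal (2 * arcosh x) * indicator {1<..} x)
      = (\<integral>\<^sup>+v. 2 * (\<integral>\<^sup>+u. K v u \<partial>lborel) * indicator {0<..<pi/2} v \<partial>lborel)"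
  proof (rule sin_ratio_integral_inner_cong, goal_cases)
    case (1 v)
    have "(\<integral>\<^sup>+u. ennreal (2 * arcosh (sin v / sin u)) * indicator {1<..} (sin v / sin u) * indicator {0<..<pi/2} u \<partial>lborel)
        = (\<integral>\<^sup>+u. 2 * K v u \<partial>lborel)"
      using 1 one_less_sin_ratio_iff[of _ v]
      by (intro nn_integral_cong) (auto simp: indicator_def K_def ennreal_mult')
    also have "\<dots> = 2 * (\<integral>\<^sup>+u. K v u \<partial>lborel)"
      unfolding K_def by (intro nn_integral_cmult) measurable
    finally show ?case .
  qed
  also have "\<dots> = (\<integral>\<^sup>+v. 2 * (\<integral>\<^sup>+u. K v u \<partial>lborel) \<partial>lborel)"
  proof (intro nn_integral_cong, goal_cases)
    case (1 v)
    have "K v u = 0" if "\<not> (0 < v \<and> v < pi/2)" for u using that by (auto simp: K_def)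
    thus ?case by (auto simp: indicator_def)
  qed
  also have "\<dots> = 2 * (\<integral>\<^sup>+v. \<integral>\<^sup>+u. K v u \<partial>lborel \<partial>lborel)"
    unfolding K_def by (intro nn_integral_cmult) measurable
  also have "(\<integral>\<^sup>+v. \<integral>\<^sup>+u. K v u \<partial>lborel \<partial>lborel) = (\<integral>\<^sup>+u. \<integral>\<^sup>+v. K v u \<partial>lborel \<partial>lborel)"
    using lborel_pair.Fubini'[OF K_meas] by simp
  also have "\<dots> = (\<integral>\<^sup>+u. ennreal (pi/2) * (ennreal (- ln (sin u)) * indicator {0<..<pi/2} u) \<partial>lborel)"
  proof (intro nn_integral_cong, goal_cases)
    case (1 u)
    show ?case
    proof (cases "0 < u \<and> u < pi/2")
      case True
      have "(\<integral>\<^sup>+v. K v u \<partial>lborel)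
          = (\<integral>\<^sup>+v. ennreal (arcosh (sin v / sin u)) * indicator {u<..<pi/2} v \<partial>lborel)"
        using True by (intro nn_integral_cong) (auto simp: K_def indicator_def)
      thus ?thesis using True by (simp add: nn_integral_arcosh_sin_ratio)
    next
      case False
      hence "K v u = 0" for v by (auto simp: K_def)
      thus ?thesis using False by auto
    qed
  qed
  also have "\<dots> = ennreal (pi/2) * ennreal (pi / 2 * ln 2)"
    by (subst nn_integral_cmult) (simp_all add: nn_integral_minus_ln_sin)
  also have "2 * \<dots> = ennreal (2 * (pi/2 * (pi / 2 * ln 2)))"
    by (simp only: ennreal_mult' pi_half_ge_zero zero_le_numeral ennreal_numeral)
  also have "2 * (pi/2 * (pi / 2 * ln 2)) = pi\<^sup>2 / 2 * ln 2" by (simp add: power2_eq_square)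
  finally show ?thesis .
qed

section \<open>The law of the real part of the diagonal entry\<close>

lemma nn_integral_Icc_eq_Ioo:
  fixes f :: "real \<Rightarrow> ennreal"
  shows "(\<integral>\<^sup>+x. f x * indicator {a..b} x \<partial>lborel) = (\<integral>\<^sup>+x. f x * indicator {a<..<b} x \<partial>lborel)"
  by (rule nn_integral_cong_AE, use AE_lborel_singleton[of a] AE_lborel_singleton[of b] in eventually_elim)
     (auto simp: indicator_def)

lemma nn_integral_abs_cos:
  assumes [measurable]: "h \<in> borel_measurable borel"
  shows "(\<integral>\<^sup>+x. h \<bar>cos x\<bar> * indicator {0..2*pi} x \<partial>lborel)
    = 4 * (\<integral>\<^sup>+x. h (sin x) * indicator {0<..<pi/2} x \<partial>lborel)"
proof -
  define I where "I = (\<integral>\<^sup>+x. h (sin x) * indicator {0<..<pi/2} x \<partial>lborel)"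
  have first: "(\<integral>\<^sup>+x. h \<bar>cos x\<bar> * indicator {0<..<pi/2} x \<partial>lborel) = I"
  proof -
    have "I = (\<integral>\<^sup>+x. h (sin (pi/2 - x)) * indicator {0<..<pi/2} x \<partial>lborel)"
      unfolding I_def by (rule nn_integral_reflect_Ioo[symmetric]) simp
    also have "\<dots> = (\<integral>\<^sup>+x. h \<bar>cos x\<bar> * indicator {0<..<pi/2} x \<partial>lborel)"
      by (intro nn_integral_cong) (auto simp: indicator_def sin_diff cos_ge_zero)
    finally show ?thesis ..
  qed
  have second: "(\<integral>\<^sup>+x. h \<bar>cos x\<bar> * indicator {pi/2<..<pi} x \<partial>lborel) = I"
    unfolding I_def
    by (subst nn_integral_real_affine[where c = 1 and t = "pi/2"])
       (auto intro!: nn_integral_cong simp: indicator_def cos_add sin_ge_zero)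
  have half: "(\<integral>\<^sup>+x. h \<bar>cos x\<bar> * indicator {0<..<pi} x \<partial>lborel) = 2 * I"
    by (subst nn_integral_split_Ioo[where b = "pi/2"]) (auto simp: first second mult_2)
  have "(\<integral>\<^sup>+x. h \<bar>cos x\<bar> * indicator {pi<..<2*pi} x \<partial>lborel) = 2 * I"
    unfolding half[symmetric]
    by (subst nn_integral_real_affine[where c = 1 and t = pi])
       (auto intro!: nn_integral_cong simp: indicator_def cos_add)
  hence "(\<integral>\<^sup>+x. h \<bar>cos x\<bar> * indicator {0<..<2*pi} x \<partial>lborel) = 2 * I + 2 * I"
    by (subst nn_integral_split_Ioo[where b = pi]) (auto simp: half)
  also have "\<dots> = 4 * I" by (simp flip: distrib_right)
  finally show ?thesis unfolding nn_integral_Icc_eq_Ioo I_def .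
qed

lemma nn_integral_uniform_circle:
  assumes [measurable]: "k \<in> borel_measurable borel"
  shows "(\<integral>\<^sup>+x. k x \<partial>uniform_circle) = (\<integral>\<^sup>+x. k (cis x) * indicator {0..2*pi} x \<partial>lborel) / ennreal (2 * pi)"
proof -
  have [measurable]: "cis \<in> borel_measurable borel"
    by (intro borel_measurable_continuous_onI continuous_on_cis continuous_on_id)
  show ?thesis
    unfolding uniform_circle_def
    by (simp add: nn_integral_distr nn_integral_uniform_measure)
qed

lemma prob_space_uniform_circle: "prob_space uniform_circle"
proof -
  have [measurable]: "cis \<in> borel_measurable borel"
    by (intro borel_measurable_continuous_onI continuous_on_cis continuous_on_id)
  interpret prob_space "uniform_measure lborel {0..2*pi}"
    by (rule prob_space_uniform_measure) auto
  show ?thesis unfolding uniform_circle_def by (rule prob_space_distr) simp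
qed

lemma nn_integral_uniform_Icc:
  assumes [measurable]: "k \<in> borel_measurable borel" and "a < b"
  shows "(\<integral>\<^sup>+x. k x \<partial>uniform_measure lborel {a..b})
    = (\<integral>\<^sup>+x. k x * indicator {a..b} x \<partial>lborel) / ennreal (b - a)"
  using assms(2) by (simp add: nn_integral_uniform_measure)

text \<open>
  The argument of \<open>c\<close> integrates out. The factor \<open>4 / \<pi>\<^sup>2\<close> collects \<open>1 / (2 \<pi>)\<close> and \<open>1 / \<pi>\<close> from the two
  uniform laws, 4 from the quarters of the circle, and 2 from the substitution \<open>\<theta> = 2 u\<close>.
\<close>
lemma nn_integral_abs_Re_random:
  assumes ps: "prob_space M" and [measurable]: "a \<in> borel_measurable M" "c \<in> borel_measurable M"
    and ac: "\<And>\<omega>. \<omega> \<in> space M \<Longrightarrow> (cmod (a \<omega>))\<^sup>2 - (cmod (c \<omega>))\<^sup>2 = 1"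
    and law: "distr M (borel \<Otimes>\<^sub>M borel \<Otimes>\<^sub>M borel)
          (\<lambda>\<omega>. (sgn (a \<omega>), sgn (c \<omega>), 2 * arcsin (1 / cmod (a \<omega>))))
        = uniform_circle \<Otimes>\<^sub>M uniform_circle \<Otimes>\<^sub>M uniform_measure lborel {0..pi}"
    and h [measurable]: "h \<in> borel_measurable borel"
  shows "(\<integral>\<^sup>+\<omega>. h \<bar>Re (a \<omega>)\<bar> \<partial>M) = ennreal (4 / pi\<^sup>2) * sin_ratio_integral h"
proof -
  have a1: "1 \<le> cmod (a \<omega>)" if "\<omega> \<in> space M" for \<omega>
  proof -
    have "1\<^sup>2 \<le> (cmod (a \<omega>))\<^sup>2"
      using ac[OF that] zero_le_power2[of "cmod (c \<omega>)"] by (simp only: one_power2)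
    thus ?thesis by (rule power2_le_imp_le) simp
  qed
  \<comment> \<open>Outside of \<open>[-1, 1]\<close> arcsin is unspecified, so it is replaced by a continuous extension.\<close>
  have arcsin_meas: "(\<lambda>\<omega>. arcsin (1 / cmod (a \<omega>))) \<in> borel_measurable M"
  proof -
    have "continuous_on UNIV (\<lambda>x::real. arcsin (max 0 (min 1 x)))"
      by (intro continuous_intros) auto
    hence [measurable]: "(\<lambda>x::real. arcsin (max 0 (min 1 x))) \<in> borel_measurable borel"
      by (rule borel_measurable_continuous_onI)
    have "(\<lambda>\<omega>. arcsin (max 0 (min 1 (1 / cmod (a \<omega>))))) \<in> borel_measurable M" by measurable
    also have "?this \<longleftrightarrow> ?thesis"
    proof (rule measurable_cong)
      fix \<omega> assume "\<omega> \<in> space M"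
      hence "0 \<le> 1 / cmod (a \<omega>)" "1 / cmod (a \<omega>) \<le> 1" using a1[of \<omega>] by (auto simp: divide_simps)
      thus "arcsin (max 0 (min 1 (1 / cmod (a \<omega>)))) = arcsin (1 / cmod (a \<omega>))"
        by (simp add: max_def min_def)
    qed
    finally show ?thesis .
  qed
  define T where "T \<omega> = (sgn (a \<omega>), sgn (c \<omega>), 2 * arcsin (1 / cmod (a \<omega>)))" for \<omega>
  have sgn_meas: "(\<lambda>\<omega>. sgn (f \<omega>)) \<in> borel_measurable M" if [measurable]: "f \<in> borel_measurable M" for f :: "_ \<Rightarrow> complex"
    unfolding sgn_div_norm by measurable
  have T[measurable]: "T \<in> M \<rightarrow>\<^sub>M borel \<Otimes>\<^sub>M borel \<Otimes>\<^sub>M borel"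
    unfolding T_def[abs_def] using arcsin_meas
    by (intro measurable_Pair sgn_meas borel_measurable_times) auto
  define g where "g = (\<lambda>(x::complex, y::complex, \<theta>). h (\<bar>Re x\<bar> / sin (\<theta> / 2)))"
  have g[measurable]: "g \<in> borel_measurable (borel \<Otimes>\<^sub>M borel \<Otimes>\<^sub>M borel)"
    unfolding g_def by measurable
  interpret U: prob_space uniform_circle by (rule prob_space_uniform_circle)
  interpret W: prob_space "uniform_measure lborel {0..pi}"
    by (rule prob_space_uniform_measure) auto
  interpret UW: pair_prob_space uniform_circle "uniform_measure lborel {0..pi}" ..
  have sU[measurable_cong]: "sets uniform_circle = sets borel" by (simp add: uniform_circle_def)
  have "(\<integral>\<^sup>+\<omega>. h \<bar>Re (a \<omega>)\<bar> \<partial>M) = (\<integral>\<^sup>+\<omega>. g (T \<omega>) \<partial>M)"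
  proof (intro nn_integral_cong)
    fix \<omega> assume "\<omega> \<in> space M"
    hence "1 \<le> cmod (a \<omega>)" by (rule a1)
    moreover from this have "- 1 \<le> 1 / cmod (a \<omega>)" "1 / cmod (a \<omega>) \<le> 1"
      by (auto simp: divide_simps)
    hence "sin (arcsin (1 / cmod (a \<omega>))) = 1 / cmod (a \<omega>)" by (rule sin_arcsin)
    moreover have "g (T \<omega>) = h (inverse (cmod (a \<omega>)) * \<bar>Re (a \<omega>)\<bar> / sin (arcsin (1 / cmod (a \<omega>))))"
      by (simp add: g_def T_def sgn_div_norm abs_mult)
    moreover have "inverse (cmod (a \<omega>)) * \<bar>Re (a \<omega>)\<bar> / (1 / cmod (a \<omega>)) = \<bar>Re (a \<omega>)\<bar>"
    proof -
      have "cmod (a \<omega>) > 0" using \<open>1 \<le> cmod (a \<omega>)\<close> by linarith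
      thus ?thesis by (simp add: divide_simps)
    qed
    ultimately show "h \<bar>Re (a \<omega>)\<bar> = g (T \<omega>)" by (simp only:)
  qed
  also have "\<dots> = (\<integral>\<^sup>+x. g x \<partial>distr M (borel \<Otimes>\<^sub>M borel \<Otimes>\<^sub>M borel) T)"
    by (rule nn_integral_distr[symmetric]) measurable
  also have "\<dots> = (\<integral>\<^sup>+x. g x \<partial>(uniform_circle \<Otimes>\<^sub>M uniform_circle \<Otimes>\<^sub>M uniform_measure lborel {0..pi}))"
    unfolding T_def[abs_def] law ..
  also have "\<dots> = (\<integral>\<^sup>+x. \<integral>\<^sup>+y. \<integral>\<^sup>+\<theta>. g (x, y, \<theta>) \<partial>uniform_measure lborel {0..pi} \<partial>uniform_circle \<partial>uniform_circle)"
    by (subst UW.nn_integral_fst[symmetric], measurable)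
       (intro nn_integral_cong, subst W.nn_integral_fst[symmetric], auto)
  also have "\<dots> = (\<integral>\<^sup>+x. \<integral>\<^sup>+\<theta>. h (\<bar>Re x\<bar> / sin (\<theta> / 2)) \<partial>uniform_measure lborel {0..pi} \<partial>uniform_circle)"
    by (simp add: g_def U.emeasure_space_1)
  also have "\<dots> = (\<integral>\<^sup>+x. (ennreal (2 / pi) * (\<integral>\<^sup>+u. h (\<bar>Re x\<bar> / sin u) * indicator {0<..<pi/2} u \<partial>lborel)) \<partial>uniform_circle)"
  proof (intro nn_integral_cong)
    fix x
    have "(\<integral>\<^sup>+\<theta>. h (\<bar>Re x\<bar> / sin (\<theta> / 2)) \<partial>uniform_measure lborel {0..pi})
      = (\<integral>\<^sup>+\<theta>. h (\<bar>Re x\<bar> / sin (\<theta> / 2)) * indicator {0<..<pi} \<theta> \<partial>lborel) / ennreal pi"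
      by (subst nn_integral_uniform_Icc) (auto simp: nn_integral_Icc_eq_Ioo)
    also have "(\<integral>\<^sup>+\<theta>. h (\<bar>Re x\<bar> / sin (\<theta> / 2)) * indicator {0<..<pi} \<theta> \<partial>lborel)
      = 2 * (\<integral>\<^sup>+u. h (\<bar>Re x\<bar> / sin u) * indicator {0<..<pi/2} u \<partial>lborel)"
      by (subst nn_integral_real_affine[where c = 2 and t = 0])
         (auto intro!: nn_integral_cong arg_cong2[where f = "(*)"] simp: indicator_def)
    also have "2 * I / ennreal pi = ennreal (2 / pi) * I" for I
    proof -
      have "ennreal 2 / ennreal pi = ennreal (2 / pi)" by (rule divide_ennreal) simp_all
      thus ?thesis by (simp add: divide_ennreal_def mult_ac flip: ennreal_numeral)
    qed
    finally show "(\<integral>\<^sup>+\<theta>. h (\<bar>Re x\<bar> / sin (\<theta> / 2)) \<partial>uniform_measure lborel {0..pi})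
      = ennreal (2 / pi) * (\<integral>\<^sup>+u. h (\<bar>Re x\<bar> / sin u) * indicator {0<..<pi/2} u \<partial>lborel)" .
  qed
  also have "\<dots> = ennreal (2 / pi) * (\<integral>\<^sup>+x. (\<integral>\<^sup>+u. h (\<bar>Re x\<bar> / sin u) * indicator {0<..<pi/2} u \<partial>lborel) \<partial>uniform_circle)"
    by (rule nn_integral_cmult) measurable
  also have "(\<integral>\<^sup>+x. (\<integral>\<^sup>+u. h (\<bar>Re x\<bar> / sin u) * indicator {0<..<pi/2} u \<partial>lborel) \<partial>uniform_circle)
     = 4 * sin_ratio_integral h / ennreal (2 * pi)"
  proof -
    have "(\<integral>\<^sup>+x. (\<integral>\<^sup>+u. h (\<bar>Re x\<bar> / sin u) * indicator {0<..<pi/2} u \<partial>lborel) \<partial>uniform_circle)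
      = (\<integral>\<^sup>+x. (\<integral>\<^sup>+u. h (\<bar>cos x\<bar> / sin u) * indicator {0<..<pi/2} u \<partial>lborel) * indicator {0..2*pi} x \<partial>lborel) / ennreal (2 * pi)"
      by (subst nn_integral_uniform_circle) auto
    also have "(\<integral>\<^sup>+x. (\<integral>\<^sup>+u. h (\<bar>cos x\<bar> / sin u) * indicator {0<..<pi/2} u \<partial>lborel) * indicator {0..2*pi} x \<partial>lborel)
      = 4 * sin_ratio_integral h"
      unfolding sin_ratio_integral_def
      by (rule nn_integral_abs_cos[where h = "\<lambda>y. \<integral>\<^sup>+u. h (y / sin u) * indicator {0<..<pi/2} u \<partial>lborel"]) measurable
    finally show ?thesis .
  qed
  also have "ennreal (2 / pi) * (4 * sin_ratio_integral h / ennreal (2 * pi))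
      = (ennreal (2 / pi) * (4 / ennreal (2 * pi))) * sin_ratio_integral h"
    by (simp add: divide_ennreal_def mult_ac)
  also have "ennreal (2 / pi) * (4 / ennreal (2 * pi)) = ennreal (2 / pi * (4 / (2 * pi)))"
  proof -
    have "ennreal 4 / ennreal (2 * pi) = ennreal (4 / (2 * pi))" by (rule divide_ennreal) simp_all
    hence "4 / ennreal (2 * pi) = ennreal (4 / (2 * pi))" by (simp only: ennreal_numeral zero_le_numeral)
    thus ?thesis by (simp only:) (rule ennreal_mult'[symmetric], simp)
  qed
  also have "2 / pi * (4 / (2 * pi)) = 4 / pi\<^sup>2" by (simp add: power2_eq_square)
  finally show ?thesis .
qed

section \<open>The law and the mean of the translation length\<close>

theorem theorem4p11:
  fixes M :: "'w measure" and f :: "'w \<Rightarrow> (complex^2^2) set"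
  assumes "random_element M f"
  shows "distributed (given_hyperbolic M f) lborel (\<lambda>\<omega>. translation_length (f \<omega>))
           (\<lambda>t. ennreal (if t > 0 then - (4 / pi\<^sup>2) * tanh (t / 2) * ln (tanh (t / 4)) else 0))
       \<and> prob_space.expectation (given_hyperbolic M f) (\<lambda>\<omega>. translation_length (f \<omega>)) = 4 * ln 2"
proof -
  obtain a c where prob: "prob_space M" and f: "f \<in> space M \<rightarrow> disk_group"
    and [measurable]: "a \<in> borel_measurable M" "c \<in> borel_measurable M"
    and ac: "\<And>\<omega>. \<omega> \<in> space M \<Longrightarrow> (cmod (a \<omega>))\<^sup>2 - (cmod (c \<omega>))\<^sup>2 = 1"
    and mat: "\<And>\<omega>. \<omega> \<in> space M \<Longrightarrow> disk_matrix (a \<omega>) (c \<omega>) \<in> f \<omega>"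
    and law: "distr M (borel \<Otimes>\<^sub>M borel \<Otimes>\<^sub>M borel)
          (\<lambda>\<omega>. (sgn (a \<omega>), sgn (c \<omega>), 2 * arcsin (1 / cmod (a \<omega>))))
        = uniform_circle \<Otimes>\<^sub>M uniform_circle \<Otimes>\<^sub>M uniform_measure lborel {0..pi}"
    using assms unfolding random_element_def by blast
  interpret M: prob_space M by (rule prob)
  note integral_Re = nn_integral_abs_Re_random[OF prob \<open>a \<in> _\<close> \<open>c \<in> _\<close> ac law]
  define X where "X \<omega> = translation_length (f \<omega>)" for \<omega>
  have PSL: "f \<omega> \<in> PSL2" if "\<omega> \<in> space M" for \<omega>
    using f that by (auto simp: disk_group_def)
  have X_eq: "X \<omega> = (if \<bar>Re (a \<omega>)\<bar> > 1 then 2 * arcosh \<bar>Re (a \<omega>)\<bar>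
     else if c \<omega> = 0 \<and> Im (a \<omega>) = 0 then 0 else (THE d. True))" if "\<omega> \<in> space M" for \<omega>
    unfolding X_def using ac[OF that] mat[OF that] PSL[OF that]
    by (intro translation_length_disk_matrix) (auto simp: disk_pair_def)
  have X_meas[measurable]: "X \<in> borel_measurable M"
    by (subst measurable_cong[OF X_eq], assumption) measurable
  define A where "A = {\<omega> \<in> space M. \<bar>Re (a \<omega>)\<bar> > 1}"
  have A[measurable]: "A \<in> sets M" unfolding A_def by measurable
  have given: "given_hyperbolic M f = uniform_measure M A"
  proof -
    have "hyperbolic (f \<omega>) \<longleftrightarrow> \<bar>Re (a \<omega>)\<bar> > 1" if "\<omega> \<in> space M" for \<omega>
      using abs_trace_disk_matrix[OF PSL[OF that] mat[OF that]] by (auto simp: hyperbolic_def)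
    hence "{\<omega> \<in> space M. hyperbolic (f \<omega>)} = A" unfolding A_def by blast
    thus ?thesis by (simp add: given_hyperbolic_def)
  qed
  have emeasure_Re: "emeasure M {\<omega> \<in> space M. \<bar>Re (a \<omega>)\<bar> \<in> S}
      = ennreal (4 / pi\<^sup>2) * sin_ratio_integral (indicator S)" if [measurable]: "S \<in> sets borel" for S
  proof -
    have "emeasure M {\<omega> \<in> space M. \<bar>Re (a \<omega>)\<bar> \<in> S}
      = (\<integral>\<^sup>+\<omega>. indicator {\<omega> \<in> space M. \<bar>Re (a \<omega>)\<bar> \<in> S} \<omega> \<partial>M)"
      by (intro nn_integral_indicator[symmetric]) measurable
    also have "\<dots> = (\<integral>\<^sup>+\<omega>. indicator S \<bar>Re (a \<omega>)\<bar> \<partial>M)"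
      by (intro nn_integral_cong) (auto simp: indicator_def)
    also have "\<dots> = ennreal (4 / pi\<^sup>2) * sin_ratio_integral (indicator S)"
      by (rule integral_Re) simp_all
    finally show ?thesis .
  qed
  have A_half: "emeasure M A = ennreal (1 / 2)"
  proof -
    have "emeasure M A = ennreal (4 / pi\<^sup>2) * ennreal (pi\<^sup>2 / 8)"
      using emeasure_Re[of "{1<..}"] by (simp add: A_def sin_ratio_integral_gt_1)
    also have "\<dots> = ennreal (4 / pi\<^sup>2 * (pi\<^sup>2 / 8))" by (rule ennreal_mult'[symmetric]) simp
    finally show ?thesis by simp
  qed
  have half: "x / emeasure M A = 2 * x" for x
  proof -
    have "inverse (ennreal (1 / 2)) = ennreal (inverse (1 / 2))" by (rule inverse_ennreal) simp
    thus ?thesis unfolding A_half divide_ennreal_def by (simp add: mult.commute)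
  qed
  define M' where "M' = uniform_measure M A"
  interpret M': prob_space M'
    unfolding M'_def by (rule prob_space_uniform_measure) (simp_all add: A_half)
  have X_meas'[measurable]: "X \<in> borel_measurable M'" by (simp add: M'_def)
  have cdf: "(\<integral>\<^sup>+t. ennreal (translation_length_density t) * indicator {..b} t \<partial>lborel)
      = emeasure M' {\<omega> \<in> space M'. X \<omega> \<le> b}" for b
  proof (cases "b > 0")
    case True
    have "{\<omega> \<in> space M. \<bar>Re (a \<omega>)\<bar> \<in> {1<..cosh (b/2)}} = A \<inter> {\<omega> \<in> space M. X \<omega> \<le> b}"
    proof -
      have "X \<omega> \<le> b \<longleftrightarrow> \<bar>Re (a \<omega>)\<bar> \<le> cosh (b/2)" if "\<omega> \<in> A" for \<omega>
      proof -
        have x: "\<omega> \<in> space M" "1 < \<bar>Re (a \<omega>)\<bar>" using that by (auto simp: A_def)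
        have "X \<omega> \<le> b \<longleftrightarrow> arcosh \<bar>Re (a \<omega>)\<bar> \<le> arcosh (cosh (b/2))"
          using x True by (simp add: X_eq arcosh_cosh_real) linarith
        also have "\<dots> \<longleftrightarrow> \<bar>Re (a \<omega>)\<bar> \<le> cosh (b/2)"
          using x arcosh_less_iff_real[of "cosh (b/2)" "\<bar>Re (a \<omega>)\<bar>"] cosh_real_ge_1[of "b/2"]
          by (simp only: not_less[symmetric]) simp
        finally show ?thesis .
      qed
      thus ?thesis by (auto simp: A_def)
    qed
    hence "emeasure M' {\<omega> \<in> space M'. X \<omega> \<le> b}
      = 2 * (ennreal (4 / pi\<^sup>2) * sin_ratio_integral (indicator {1<..cosh (b/2)}))"
      using emeasure_Re[of "{1<..cosh (b/2)}"]
      by (simp add: M'_def half)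
    also have "\<dots> = ennreal (8 / pi\<^sup>2) * sin_ratio_integral (indicator {1<..cosh (b/2)})"
      by (simp add: mult.assoc[symmetric] flip: ennreal_numeral ennreal_mult')
    finally show ?thesis by (simp add: nn_integral_translation_length_density[OF True])
  next
    case False
    have "X \<omega> > 0" if "\<omega> \<in> A" for \<omega> using that by (simp add: A_def X_eq)
    hence "A \<inter> {\<omega> \<in> space M. X \<omega> \<le> b} = {}" using False by force
    moreover have "(\<lambda>t. ennreal (translation_length_density t) * indicator {..b} t) = (\<lambda>_. 0)"
      using False by (auto simp: translation_length_density_def indicator_def)
    ultimately show ?thesis by (simp add: M'_def)
  qed
  have ind: "ennreal (translation_length_density t * indicator {..b} t) = ennreal (translation_length_density t) * indicator {..b} t" for b t
    by (simp add: indicator_def)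
  have "distributed M' lborel X (\<lambda>t. ennreal (translation_length_density t))"
    by (rule distributedI_borel_atMost[where g = "\<lambda>b. M'.prob {\<omega> \<in> space M'. X \<omega> \<le> b}"])
       (simp_all add: translation_length_density_nonneg ind cdf M'.emeasure_eq_measure)
  moreover have "has_bochner_integral M' X (4 * ln 2)"
  proof (rule has_bochner_integral_nn_integral)
    have X_pos: "0 \<le> X \<omega>" if "\<omega> \<in> A" for \<omega> using that by (simp add: A_def X_eq)
    thus "AE \<omega> in M'. 0 \<le> X \<omega>"
      unfolding M'_def by (intro AE_uniform_measureI) auto
    have "(\<integral>\<^sup>+\<omega>. X \<omega> \<partial>M') = 2 * (\<integral>\<^sup>+\<omega>. ennreal (X \<omega>) * indicator A \<omega> \<partial>M)"
      unfolding M'_def by (subst nn_integral_uniform_measure) (simp_all add: half)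
    also have "(\<integral>\<^sup>+\<omega>. ennreal (X \<omega>) * indicator A \<omega> \<partial>M)
        = (\<integral>\<^sup>+\<omega>. ennreal (2 * arcosh \<bar>Re (a \<omega>)\<bar>) * indicator {1<..} \<bar>Re (a \<omega>)\<bar> \<partial>M)"
      by (intro nn_integral_cong) (auto simp: A_def X_eq indicator_def)
    also have "\<dots> = ennreal (4 / pi\<^sup>2) * ennreal (pi\<^sup>2 / 2 * ln 2)"
      unfolding sin_ratio_integral_arcosh[symmetric]
      by (rule integral_Re[where h = "\<lambda>x. ennreal (2 * arcosh x) * indicator {1<..} x"]) simp_all
    also have "2 * (ennreal (4 / pi\<^sup>2) * ennreal (pi\<^sup>2 / 2 * ln 2)) = ennreal (2 * (4 / pi\<^sup>2 * (pi\<^sup>2 / 2 * ln 2)))"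
      by (simp only: ennreal_mult' ennreal_numeral zero_le_numeral divide_nonneg_nonneg zero_le_power2)
    also have "2 * (4 / pi\<^sup>2 * (pi\<^sup>2 / 2 * ln 2)) = 4 * ln 2" by simp
    finally show "(\<integral>\<^sup>+\<omega>. X \<omega> \<partial>M') = ennreal (4 * ln 2)" .
  qed simp_all
  ultimately show ?thesis
    unfolding given M'_def[symmetric] X_def[symmetric] translation_length_density_def[symmetric]
    by (simp add: has_bochner_integral_integral_eq)
qed

end
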